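(* Let $\Bbbk$ be a field, $\mathsf C$ a small category and $\mathcal A:\mathsf C\to\mathsf{Vec}_\Bbbk$ a functor. The asimplicial subcomplex $\mathsf s_2C^{\bullet,\bullet}_{\mathrm a}(\mathcal A,\mathcal A)$, where $C^{\bullet,\bullet}_{\mathrm a}(\mathcal A,\mathcal A)=\bigoplus_{p\ge0}\bigoplus_{q\ge1}C^{p,q}(\mathcal A,\mathcal A)$, is a $\mathit{Quilt}$-subalgebra of $\mathsf s_2C^{\bullet,\bullet}(\mathcal A,\mathcal A)$ (a subcomplex for $\delta^{\mathrm S}$ closed under all the operations $\widehat Q$, $Q$ a quilt).
   Context: Write $\langle n\rangle=\{1,\dots,n\}$, $[p]=\{0,\dots,p\}$. TREES. A tree $T$ consists of a finite set $V_T$ (vertices), a set $E_T\subset V_T\times V_T$ (edges) and a partial order $\trianglelefteq_T$ on $V_T$ (strict part $\vartriangleleft_T$) such that: $(u,u)\notin E_T$; $E_T$ generates a partial order $\le_T$ with $(u,v)\in E_T\Rightarrow u<_Tv$; there is a unique $\le_T$-minimal vertex (the root); if $(u,v)\in E_T$ there is no $t$ with $u<_Tt<_Tv$; for all $u,v$ exactly one of $u=v$, $u<_Tv$, $u>_Tv$, $u\vartriangleleft_Tv$, $u\vartriangleright_Tv$ holds; if $u\vartriangleleft_Tv$, $u\le_Tu'$, $v\le_Tv'$ then $u'\vartriangleleft_Tv'$. If $(u,v)\in E_T$, $v$ is a child of $u$. $\mathsf{Tree}(n)$ is the set of trees with vertex set $\langle n\rangle$. WORDS. $\mathsf{F_2S}(n)$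 is the set of words (finite sequences) $W$ over $\langle n\rangle$ such that every element of $\langle n\rangle$ appears, no element appears twice consecutively, and for $u\ne v$ there is no subsequence $u,v,u,v$. $|W|$ is the length and $\deg W=|W|-n$. Elements of $\langle n\rangle$ are called vertices. QUILTS. $\mathsf{Quilt}(n)$ is the set of pairs $Q=(W_Q,T_Q)\in\mathsf{F_2S}(n)\times\mathsf{Tree}(n)$ such that (1) if some occurrence of $u$ precedes some occurrence of $v$ in $W_Q$ then not $u>_{T_Q}v$; (2) if some occurrence of $v$ lies between two occurrences of $u$ in $W_Q$ then $v\trianglelefteq_{T_Q}u$. $\deg Q=\deg W_Q$, arity $\#Q=n$. The quilts of arity $n$ span the arity $n$ part of a dg-operad $\mathit{Quilt}$, which acts on $\mathsf s_2C^{\bullet,\bullet}(\mathcal A,\mathcal A)$ by the operations $\widehat Q$ below. OCCURRENCES. $\underline a$ denotes an occurrence (position) of $a$ in $W$. The $\downarrow$ order is the order of first occurrences in $W$. If $W=\dots uv\dots u\dots$ ($v$ immediately after an occurrence of $u$, and $u$ occurs again later), $v$ is interposed; there are $\deg W$ interposed vertices. COCHAINS. $B_p\mathsf C$ is the set of strings $\boldsymbol\phi=(\phi_1,\dots,\phi_p)$, $x_0\xleftarrow{\phi_1}x_1\leftarrow\dots\xleftarrow{\phi_p}x_p$ in $\mathsf C$ (objects if $p=0$). $\phi_{k,l}=\phi_{k+1}\circ\dots\circ\phi_l:x_l\to x_k$ (identity if $k=l$). For strictly increasing $\zeta:[p]\to[p']$ and $\boldsymbol\phi\in B_{p'}\mathsf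 C$, $\zeta^*\boldsymbol\phi=(\phi_{\zeta(0),\zeta(1)},\dots,\phi_{\zeta(p-1),\zeta(p)})\in B_p\mathsf C$ (the object $x_{\zeta(0)}$ if $p=0$). $C^{p,q}(\mathcal A,\mathcal A)=\prod_{(x_0\leftarrow\dots\leftarrow x_p)\in B_p\mathsf C}\operatorname{Hom}_\Bbbk(\mathcal A(x_p)^{\otimes q},\mathcal A(x_0))$; the component of $f$ at $\boldsymbol\phi$ is $f[\boldsymbol\phi]$. For $f\in C^{p,q}$, the shifted bidegree is $\|f\|=(p,q-1)$ and $|f|=p+q-1$; $\mathsf s_2C^{\bullet,\bullet}$ is $C^{\bullet,\bullet}$ graded by shifted bidegree. $\delta^{\mathrm S}:C^{p,q}\to C^{p+1,q}$ is $\delta^{\mathrm S}=\sum_{i=0}^{p+1}(-1)^i\delta^{\mathrm S}_i$, $(\delta^{\mathrm S}_if)[\boldsymbol\phi]=\mathcal A[\phi_{0,\varepsilon_i(0)}]\circ f[\varepsilon_i^*\boldsymbol\phi]\circ\mathcal A[\phi_{\varepsilon_i(p),p+1}]^{\otimes q}$, where $\varepsilon_i:[p]\to[p+1]$ is the strictly increasing map whose image omits $i$. COLORINGS. Let $T\in\mathsf{Tree}(n)$, $W\in\mathsf{F_2S}(n)$, $\mathbf p,\mathbf q\in\mathbb N^n$ ($\mathbb N\ni0$), $q'=1+\sum_a(q_a-1)$, $p'=\sum_ap_a-\deg W$. $\mathrm{Clr}(T;\mathbf q)$ is the set of $I:E_T\to\mathbb N$ with $1\le I_{(u,v)}\le q_u$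 for every edge, and $I_{(t,u)}<I_{(t,v)}$ whenever $u\vartriangleleft_Tv$ are children of $t$. $\mathrm{Clr}(W;\mathbf p)$ is the set of tuples $\boldsymbol\zeta=(\zeta_1,\dots,\zeta_n)$ of strictly increasing maps $\zeta_a:[p_a]\to[p']$ with $\bigcup_a\operatorname{Im}\zeta_a=[p']$ for which there exist (necessarily unique) functions $\pi_a:[p_a]\to W$ such that the image of $\pi_a$ is the set of occurrences of $a$ in $W$; $\zeta_a(\pi_a^{-1}\underline a)$ is a set of consecutive integers for every occurrence $\underline a$; and whenever $\underline b$ immediately follows $\underline a$ in $W$, $\max\zeta_a(\pi_a^{-1}\underline a)=\min\zeta_b(\pi_b^{-1}\underline b)$. (Empty if $p'<0$.) For a quilt $Q$, $\boldsymbol\zeta\in\mathrm{Clr}(W_Q;\mathbf p)$, $I\in\mathrm{Clr}(T_Q;\mathbf q)$, one has $\max\zeta_a\le\min\zeta_b$ for each edge $(a,b)$. ACTION OF A COLORING. For $f_a\in C^{p_a,q_a}(\mathcal A,\mathcal A)$ and $\boldsymbol\phi\in B_{p'}\mathsf C$, $\mathcal L(\boldsymbol\zeta,I;f_1,\dots,f_n)[\boldsymbol\phi]:\mathcal A(x_{p'})^{\otimes q'}\to\mathcal A(x_0)$ is the composite of the multilinear maps $f_a[\zeta_a^*\boldsymbol\phi]:\mathcal A(x_{\zeta_a(p_a)})^{\otimes q_a}\to\mathcal A(x_{\zeta_a(0)})$ along the tree: for each edge $(a,b)$ the output of $f_b[\zeta_b^*\boldsymbol\phi]$, after applying $\mathcal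 A[\phi_{\zeta_a(p_a),\zeta_b(0)}]$, is inserted in the $I_{(a,b)}$-th input of $f_a[\zeta_a^*\boldsymbol\phi]$; each input of $f_a[\zeta_a^*\boldsymbol\phi]$ not used by an edge is precomposed with $\mathcal A[\phi_{\zeta_a(p_a),p'}]$ (remaining inputs in planar order); the output at the root $u$ is followed by $\mathcal A[\phi_{0,\zeta_u(0)}]$. SIGNS. Use letters $0_{\mathrm va},\dots,(p_a-1)_{\mathrm va}$ and $1_{\mathrm ha},\dots,(q_a-1)_{\mathrm ha}$ for each vertex $a$. Initial word: the concatenation over $a=1,\dots,\#Q$ (in this order) of $0_{\mathrm va}\dots(p_a-1)_{\mathrm va}1_{\mathrm ha}\dots(q_a-1)_{\mathrm ha}$. Shuffled word: the concatenation of three words: (i) $0_{\mathrm va}$ for each interposed vertex $a$ of $W_Q$, in reverse $\downarrow$ order; (ii) the word having $i_{\mathrm va}$ in position $\zeta_a(i)$ (positions counted from $0$), for $0\le i\le p_a-1$ if $a$ is not interposed and $1\le i\le p_a-1$ if $a$ is interposed; (iii) the word obtained from the corner word of $T_Q$ (the word $C(\mathrm{root})$, where $C(v)=v\,C(c_1)\,v\,C(c_2)\,v\dots C(c_r)\,v$ for a vertex with children $c_1\vartriangleleft\dots\vartriangleleft c_r$) by replacing, in order, each non-last occurrence of $a$ immediately followed by $b$ with the next unused horizontal letters of $a$ up to $(I_{(a,b)}-1)_{\mathrm ha}$, and the last occurrence of $a$ with the remaining horizontal letters of $a$. If $p_a\ge1$ for all interposed $a$ and $q_a\ge1$ for all $a$,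 $\operatorname{sgn}_Q(\boldsymbol\zeta,I)$ is the sign of the permutation taking the initial word to the shuffled word. Otherwise it is defined by replacing each $q_a=0$ by $2$, and, for each interposed $a$ with $p_a=0$ (so $a$ occurs only once, at $\underline a$), replacing $\boldsymbol\zeta$ by $E_{\underline a}E_{\underline a}\boldsymbol\zeta$, where $E_{\underline a}\boldsymbol\zeta$ is the coloring with $p_a$ increased by $1$ such that $j\in\operatorname{Im}(E_{\underline a}\boldsymbol\zeta)_b$ iff $j=\zeta_b(i)$ with $\pi_b(i)$ before or equal to $\underline a$, or $j=1+\zeta_b(i)$ with $\pi_b(i)$ after or equal to $\underline a$. OPERATIONS. For $Q\in\mathsf{Quilt}(n)$ and $f_a\in C^{p_a,q_a}(\mathcal A,\mathcal A)$, $\widehat Q(f_1,\dots,f_n)=\sum_{\boldsymbol\zeta\in\mathrm{Clr}(W_Q;\mathbf p)}\sum_{I\in\mathrm{Clr}(T_Q;\mathbf q)}\operatorname{sgn}_Q(\boldsymbol\zeta,I)\,\mathcal L(\boldsymbol\zeta,I;f_1,\dots,f_n)\in C^{p',q'}(\mathcal A,\mathcal A)$, extended multilinearly. *)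

theory Defs
  imports
    "HOL-Algebra.Module"
    "HOL-Combinatorics.Permutations"
    "HOL-Library.Sublist"
begin

section \<open>Trees\<close>

record 'a planar_tree =
  verts :: "'a set"
  edges :: "('a \<times> 'a) set"
  hord :: "('a \<times> 'a) set"

definition tree_le :: "'a planar_tree \<Rightarrow> 'a \<Rightarrow> 'a \<Rightarrow> bool" where
  "tree_le T u v \<longleftrightarrow> u \<in> verts T \<and> v \<in> verts T \<and> (u, v) \<in> (edges T)\<^sup>*"

definition tree_less :: "'a planar_tree \<Rightarrow> 'a \<Rightarrow> 'a \<Rightarrow> bool" where
  "tree_less T u v \<longleftrightarrow> tree_le T u v \<and> u \<noteq> v"

definition left_of :: "'a planar_tree \<Rightarrow> 'a \<Rightarrow> 'a \<Rightarrow> bool" where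
  "left_of T u v \<longleftrightarrow> (u, v) \<in> hord T \<and> u \<noteq> v"

definition is_root :: "'a planar_tree \<Rightarrow> 'a \<Rightarrow> bool" where
  "is_root T r \<longleftrightarrow> r \<in> verts T \<and> (\<forall>v. tree_le T v r \<longrightarrow> v = r)"

definition tree_root :: "'a planar_tree \<Rightarrow> 'a" where
  "tree_root T = (THE r. is_root T r)"

definition exactly_one :: "bool list \<Rightarrow> bool" where
  "exactly_one bs \<longleftrightarrow> length (filter id bs) = 1"

definition is_tree :: "'a planar_tree \<Rightarrow> bool" where
  "is_tree T \<longleftrightarrow>
     finite (verts T) \<and>
     edges T \<subseteq> verts T \<times> verts T \<and>
     partial_order_on (verts T) (hord T) \<and>
     (\<forall>u. (u, u) \<notin> edges T) \<and>
     partial_order_on (verts T) {(u, v). tree_le T u v} \<and>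
     (\<exists>!r. is_root T r) \<and>
     (\<forall>u v. (u, v) \<in> edges T \<longrightarrow> \<not> (\<exists>t. tree_less T u t \<and> tree_less T t v)) \<and>
     (\<forall>u\<in>verts T. \<forall>v\<in>verts T.
        exactly_one [u = v, tree_less T u v, tree_less T v u, left_of T u v, left_of T v u]) \<and>
     (\<forall>u v u' v'. left_of T u v \<and> tree_le T u u' \<and> tree_le T v v' \<longrightarrow> left_of T u' v')"

definition Tree :: "nat \<Rightarrow> nat planar_tree set" where
  "Tree n = {T. is_tree T \<and> verts T = {1..n}}"

text \<open>The functions below recurse over a tree from a vertex towards the leaves; the following
  lemma is their common termination argument.\<close>

definition descendants :: "'a planar_tree \<Rightarrow> 'a \<Rightarrow> 'a set" where
  "descendants T v = {w. (v, w) \<in> (edges T)\<^sup>+}"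

lemma card_descendants_less:
  assumes T: "is_tree T" and e: "(a, b) \<in> edges T"
  shows "card (descendants T b) < card (descendants T a)"
proof (rule psubset_card_mono)
  have E: "edges T \<subseteq> verts T \<times> verts T" and fin: "finite (verts T)"
    and po: "partial_order_on (verts T) {(u, v). tree_le T u v}"
    and irr: "\<And>u. (u, u) \<notin> edges T"
    using T by (auto simp: is_tree_def)
  have "descendants T a \<subseteq> verts T"
    using trancl_subset_Sigma[OF E] by (auto simp: descendants_def)
  then show "finite (descendants T a)"
    using fin finite_subset by blast
  have "(b, b) \<notin> (edges T)\<^sup>+"
  proof
    assume "(b, b) \<in> (edges T)\<^sup>+"
    then obtain c where c: "(b, c) \<in> edges T" "(c, b) \<in> (edges T)\<^sup>*"
      by (meson tranclD)
    then have "tree_le T b c" "tree_le T c b"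
      using E by (auto simp: tree_le_def)
    then have "b = c"
      using partial_order_onD(3)[OF po] by (auto simp: antisym_def)
    with c irr show False by blast
  qed
  moreover have "b \<in> descendants T a"
    using e by (auto simp: descendants_def)
  moreover have "descendants T b \<subseteq> descendants T a"
    using e by (auto simp: descendants_def intro: trancl_into_trancl2)
  ultimately show "descendants T b \<subset> descendants T a"
    by (auto simp: descendants_def)
qed

text \<open>The children of a vertex in planar order: siblings are totally ordered by \<open>left_of\<close>, so
  sorting them by the number of siblings to their left is sorting them along \<open>left_of\<close>.\<close>

definition children :: "nat planar_tree \<Rightarrow> nat \<Rightarrow> nat list" where
  "children T v =
     sort_key (\<lambda>c. card {b. (v, b) \<in> edges T \<and> left_of T b c})
       (sorted_list_of_set {c. (v, c) \<in> edges T})"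

lemma set_children:
  assumes "is_tree T"
  shows "set (children T v) = {c. (v, c) \<in> edges T}"
proof -
  have "{c. (v, c) \<in> edges T} \<subseteq> verts T"
    using assms by (auto simp: is_tree_def)
  then have "finite {c. (v, c) \<in> edges T}"
    using assms finite_subset by (auto simp: is_tree_def)
  then show ?thesis
    by (simp add: children_def)
qed

function corner_word :: "nat planar_tree \<Rightarrow> nat \<Rightarrow> nat list" where
  "corner_word T v =
     (if is_tree T then v # concat (map (\<lambda>c. corner_word T c @ [v]) (children T v)) else [])"
  by auto
termination
  by (relation "measure (\<lambda>(T, v). card (descendants T v))")
    (auto simp: set_children card_descendants_less)

declare corner_word.simps [simp del]


section \<open>Words and quilts\<close>

definition F2S :: "nat \<Rightarrow> nat list set" where
  "F2S n = {W. set W = {1..n} \<and>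
     (\<forall>i. Suc i < length W \<longrightarrow> W ! i \<noteq> W ! Suc i) \<and>
     (\<forall>u v. u \<noteq> v \<longrightarrow> \<not> subseq [u, v, u, v] W)}"

text \<open>Every letter occurs in a word of \<open>F2S n\<close>, so the subtraction does not truncate.\<close>

definition word_deg :: "nat \<Rightarrow> nat list \<Rightarrow> nat" where
  "word_deg n W = length W - n"

definition interposed :: "nat list \<Rightarrow> nat \<Rightarrow> bool" where
  "interposed W v \<longleftrightarrow>
     (\<exists>i k. Suc i < k \<and> k < length W \<and> W ! Suc i = v \<and> W ! k = W ! i)"

text \<open>The vertices of a word in the order of their first occurrences.\<close>

definition down_order :: "nat list \<Rightarrow> nat list" where
  "down_order W = rev (remdups (rev W))"

definition Quilt :: "nat \<Rightarrow> (nat list \<times> nat planar_tree) set" where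
  "Quilt n = {(W, T). W \<in> F2S n \<and> T \<in> Tree n \<and>
     (\<forall>i j. i < j \<and> j < length W \<longrightarrow> \<not> tree_less T (W ! j) (W ! i)) \<and>
     (\<forall>i j k. i < j \<and> j < k \<and> k < length W \<and> W ! i = W ! k \<longrightarrow> (W ! j, W ! i) \<in> hord T)}"


section \<open>Colorings\<close>

definition out_p :: "nat \<Rightarrow> nat list \<Rightarrow> (nat \<Rightarrow> nat) \<Rightarrow> nat" where
  "out_p n W p = (\<Sum>a\<in>{1..n}. p a) - word_deg n W"

text \<open>This is \<open>1 + (\<Sum>a. q a - 1)\<close>, computed in the natural numbers.  If that integer is negative,
  then a tree with \<open>n - 1\<close> edges has no coloring, so the truncated value plays no role.\<close>

definition out_q :: "nat \<Rightarrow> (nat \<Rightarrow> nat) \<Rightarrow> nat" where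
  "out_q n q = (1 + (\<Sum>a\<in>{1..n}. q a)) - n"

definition tree_colorings ::
    "nat planar_tree \<Rightarrow> (nat \<Rightarrow> nat) \<Rightarrow> (nat \<times> nat \<Rightarrow> nat) set" where
  "tree_colorings T q = {I \<in> extensional (edges T).
     (\<forall>u v. (u, v) \<in> edges T \<longrightarrow> 1 \<le> I (u, v) \<and> I (u, v) \<le> q u) \<and>
     (\<forall>t u v. (t, u) \<in> edges T \<and> (t, v) \<in> edges T \<and> left_of T u v \<longrightarrow> I (t, u) < I (t, v))}"

definition block ::
    "(nat \<Rightarrow> nat) \<Rightarrow> (nat \<Rightarrow> nat \<Rightarrow> nat) \<Rightarrow> (nat \<Rightarrow> nat \<Rightarrow> nat) \<Rightarrow> nat \<Rightarrow> nat \<Rightarrow> nat set" where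
  "block p \<zeta> \<pi> a i = \<zeta> a ` {k \<in> {0..p a}. \<pi> a k = i}"

text \<open>Occurrences are represented by positions in the word, counted from 0.\<close>

definition is_projection ::
    "nat \<Rightarrow> nat list \<Rightarrow> (nat \<Rightarrow> nat) \<Rightarrow> (nat \<Rightarrow> nat \<Rightarrow> nat) \<Rightarrow> (nat \<Rightarrow> nat \<Rightarrow> nat) \<Rightarrow> bool" where
  "is_projection n W p \<zeta> \<pi> \<longleftrightarrow>
     \<pi> \<in> (\<Pi>\<^sub>E a\<in>{1..n}. {0..p a} \<rightarrow>\<^sub>E {..<length W}) \<and>
     (\<forall>a\<in>{1..n}. \<pi> a ` {0..p a} = {i. i < length W \<and> W ! i = a}) \<and>
     (\<forall>i<length W. \<exists>l u. block p \<zeta> \<pi> (W ! i) i = {l..u}) \<and>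
     (\<forall>i. Suc i < length W \<longrightarrow>
        Max (block p \<zeta> \<pi> (W ! i) i) = Min (block p \<zeta> \<pi> (W ! Suc i) (Suc i)))"

definition word_colorings ::
    "nat \<Rightarrow> nat list \<Rightarrow> (nat \<Rightarrow> nat) \<Rightarrow> (nat \<Rightarrow> nat \<Rightarrow> nat) set" where
  "word_colorings n W p = {\<zeta> \<in> (\<Pi>\<^sub>E a\<in>{1..n}. {0..p a} \<rightarrow>\<^sub>E {0..out_p n W p}).
     word_deg n W \<le> (\<Sum>a\<in>{1..n}. p a) \<and>
     (\<forall>a\<in>{1..n}. strict_mono_on {0..p a} (\<zeta> a)) \<and>
     (\<Union>a\<in>{1..n}. \<zeta> a ` {0..p a}) = {0..out_p n W p} \<and>
     (\<exists>\<pi>. is_projection n W p \<zeta> \<pi>)}"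

definition projection ::
    "nat \<Rightarrow> nat list \<Rightarrow> (nat \<Rightarrow> nat) \<Rightarrow> (nat \<Rightarrow> nat \<Rightarrow> nat) \<Rightarrow> nat \<Rightarrow> nat \<Rightarrow> nat" where
  "projection n W p \<zeta> = (THE \<pi>. is_projection n W p \<zeta> \<pi>)"


section \<open>Signs\<close>

text \<open>\<open>Va i a\<close> and \<open>Ha i a\<close> are the \<open>i\<close>-th vertical and horizontal letters of the vertex \<open>a\<close>.\<close>

datatype letter = Va nat nat | Ha nat nat

definition initial_word :: "nat \<Rightarrow> (nat \<Rightarrow> nat) \<Rightarrow> (nat \<Rightarrow> nat) \<Rightarrow> letter list" where
  "initial_word n p q =
     concat (map (\<lambda>a. map (\<lambda>i. Va i a) [0..<p a] @ map (\<lambda>i. Ha i a) [1..<q a]) [1..<Suc n])"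

definition vertical_word ::
    "nat \<Rightarrow> nat list \<Rightarrow> (nat \<Rightarrow> nat) \<Rightarrow> (nat \<Rightarrow> nat \<Rightarrow> nat) \<Rightarrow> letter list" where
  "vertical_word n W p \<zeta> =
     map (\<lambda>j. THE x. \<exists>a i. x = Va i a \<and> a \<in> {1..n} \<and> i < p a \<and>
                (interposed W a \<longrightarrow> 1 \<le> i) \<and> \<zeta> a i = j)
       [0..<out_p n W p]"

text \<open>The third argument gives the next unused horizontal letter of each vertex; the last argument is
  the part of the corner word that is still to be processed.\<close>

fun horizontal_word ::
    "(nat \<Rightarrow> nat) \<Rightarrow> (nat \<times> nat \<Rightarrow> nat) \<Rightarrow> (nat \<Rightarrow> nat) \<Rightarrow> nat list \<Rightarrow> letter list" where
  "horizontal_word q I nxt [] = []"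
| "horizontal_word q I nxt (a # w) =
     (let m = (if a \<in> set w then I (a, hd w) else q a)
      in map (\<lambda>i. Ha i a) [nxt a..<m] @ horizontal_word q I (nxt(a := m)) w)"

definition shuffled_word ::
    "nat \<Rightarrow> nat list \<Rightarrow> nat planar_tree \<Rightarrow> (nat \<Rightarrow> nat) \<Rightarrow> (nat \<Rightarrow> nat) \<Rightarrow>
     (nat \<Rightarrow> nat \<Rightarrow> nat) \<Rightarrow> (nat \<times> nat \<Rightarrow> nat) \<Rightarrow> letter list" where
  "shuffled_word n W T p q \<zeta> I =
     map (Va 0) (rev (filter (interposed W) (down_order W))) @
     vertical_word n W p \<zeta> @
     horizontal_word q I (\<lambda>_. 1) (corner_word T (tree_root T))"

definition word_sign :: "'a list \<Rightarrow> 'a list \<Rightarrow> int" where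
  "word_sign xs ys = sign (THE \<sigma>. \<sigma> permutes {..<length xs} \<and> permute_list \<sigma> xs = ys)"

text \<open>\<open>expand n W j\<close> is the operation \<open>E\<close> at the occurrence in position \<open>j\<close>; each new map
  is the increasing enumeration of its prescribed image.\<close>

definition expand ::
    "nat \<Rightarrow> nat list \<Rightarrow> nat \<Rightarrow> (nat \<Rightarrow> nat) \<times> (nat \<Rightarrow> nat \<Rightarrow> nat) \<Rightarrow>
     (nat \<Rightarrow> nat) \<times> (nat \<Rightarrow> nat \<Rightarrow> nat)" where
  "expand n W j = (\<lambda>(p, \<zeta>).
     let \<pi> = projection n W p \<zeta>;
         p' = p(W ! j := Suc (p (W ! j)));
         im = (\<lambda>b. {\<zeta> b i |i. i \<le> p b \<and> \<pi> b i \<le> j} \<union> {1 + \<zeta> b i |i. i \<le> p b \<and> j \<le> \<pi> b i})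
     in (p', \<lambda>b\<in>{1..n}. \<lambda>i\<in>{0..p' b}. sorted_list_of_set (im b) ! i))"

text \<open>A vertex \<open>a\<close> with \<open>p a = 0\<close> occurs exactly once in a word admitting a coloring.\<close>

definition expand_all ::
    "nat \<Rightarrow> nat list \<Rightarrow> (nat \<Rightarrow> nat) \<Rightarrow> (nat \<Rightarrow> nat \<Rightarrow> nat) \<Rightarrow>
     (nat \<Rightarrow> nat) \<times> (nat \<Rightarrow> nat \<Rightarrow> nat)" where
  "expand_all n W p \<zeta> =
     fold (\<lambda>a. let j = (THE j. j < length W \<and> W ! j = a) in expand n W j \<circ> expand n W j)
       (filter (\<lambda>a. interposed W a \<and> p a = 0) [1..<Suc n]) (p, \<zeta>)"

definition quilt_sign ::
    "nat \<Rightarrow> nat list \<Rightarrow> nat planar_tree \<Rightarrow> (nat \<Rightarrow> nat) \<Rightarrow> (nat \<Rightarrow> nat) \<Rightarrow>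
     (nat \<Rightarrow> nat \<Rightarrow> nat) \<Rightarrow> (nat \<times> nat \<Rightarrow> nat) \<Rightarrow> int" where
  "quilt_sign n W T p q \<zeta> I =
     (let q' = (\<lambda>a. if q a = 0 then 2 else q a);
          (p', \<zeta>') = expand_all n W p \<zeta>
      in word_sign (initial_word n p' q') (shuffled_word n W T p' q' \<zeta>' I))"


section \<open>Categories and functors to vector spaces\<close>

record ('o, 'm) cat =
  Obj :: "'o set"
  Arr :: "'m set"
  Dom :: "'m \<Rightarrow> 'o"
  Cod :: "'m \<Rightarrow> 'o"
  Idt :: "'o \<Rightarrow> 'm"
  Cmp :: "'m \<Rightarrow> 'm \<Rightarrow> 'm"

definition arrows :: "('o, 'm) cat \<Rightarrow> 'o \<Rightarrow> 'o \<Rightarrow> 'm set" where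
  "arrows C x y = {f \<in> Arr C. Dom C f = x \<and> Cod C f = y}"

locale small_category =
  fixes C :: "('o, 'm) cat"
  assumes Dom_in: "f \<in> Arr C \<Longrightarrow> Dom C f \<in> Obj C"
    and Cod_in: "f \<in> Arr C \<Longrightarrow> Cod C f \<in> Obj C"
    and Idt_in: "x \<in> Obj C \<Longrightarrow> Idt C x \<in> arrows C x x"
    and Cmp_in: "f \<in> arrows C x y \<Longrightarrow> g \<in> arrows C y z \<Longrightarrow> Cmp C g f \<in> arrows C x z"
    and Cmp_Idt_left: "f \<in> arrows C x y \<Longrightarrow> Cmp C (Idt C y) f = f"
    and Cmp_Idt_right: "f \<in> arrows C x y \<Longrightarrow> Cmp C f (Idt C x) = f"
    and Cmp_assoc: "f \<in> arrows C x y \<Longrightarrow> g \<in> arrows C y z \<Longrightarrow> h \<in> arrows C z w \<Longrightarrow>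
      Cmp C h (Cmp C g f) = Cmp C (Cmp C h g) f"

definition linear_maps ::
    "('k, 'r) ring_scheme \<Rightarrow> ('k, 'v) module \<Rightarrow> ('k, 'w) module \<Rightarrow> ('v \<Rightarrow> 'w) set" where
  "linear_maps K V W = {h \<in> carrier V \<rightarrow> carrier W.
     (\<forall>x\<in>carrier V. \<forall>y\<in>carrier V. h (x \<oplus>\<^bsub>V\<^esub> y) = h x \<oplus>\<^bsub>W\<^esub> h y) \<and>
     (\<forall>c\<in>carrier K. \<forall>x\<in>carrier V. h (c \<odot>\<^bsub>V\<^esub> x) = c \<odot>\<^bsub>W\<^esub> h x)}"

record ('o, 'm, 'k, 'v) vect_functor =
  FObj :: "'o \<Rightarrow> ('k, 'v) module"
  FArr :: "'m \<Rightarrow> 'v \<Rightarrow> 'v"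

text \<open>The vector spaces \<open>FObj A x\<close> may have different carriers, zeros and operations; only the
  type of their elements is shared.\<close>

locale functor_to_vect = field K + small_category C
  for K :: "('k, 'r) ring_scheme" (structure) and C :: "('o, 'm) cat" +
  fixes A :: "('o, 'm, 'k, 'v) vect_functor"
  assumes FObj_vector_space: "x \<in> Obj C \<Longrightarrow> module K (FObj A x)"
    and FArr_linear: "f \<in> arrows C x y \<Longrightarrow> FArr A f \<in> linear_maps K (FObj A x) (FObj A y)"
    and FArr_Idt: "x \<in> Obj C \<Longrightarrow> v \<in> carrier (FObj A x) \<Longrightarrow> FArr A (Idt C x) v = v"
    and FArr_Cmp: "f \<in> arrows C x y \<Longrightarrow> g \<in> arrows C y z \<Longrightarrow> v \<in> carrier (FObj A x) \<Longrightarrow>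
      FArr A (Cmp C g f) v = FArr A g (FArr A f v)"


section \<open>Cochains\<close>

text \<open>A string \<open>x\<^sub>0 \<leftarrow> x\<^sub>1 \<leftarrow> \<dots> \<leftarrow> x\<^sub>p\<close> is the pair of its list of objects and its list of
  arrows.  The arrow \<open>x\<^sub>i \<leftarrow> x\<^bsub>i+1\<^esub>\<close> has list index \<open>i\<close>.\<close>

type_synonym ('o, 'm) string = "'o list \<times> 'm list"

definition strings :: "('o, 'm) cat \<Rightarrow> nat \<Rightarrow> ('o, 'm) string set" where
  "strings C p = {(xs, fs). length xs = Suc p \<and> length fs = p \<and> set xs \<subseteq> Obj C \<and>
     (\<forall>i<p. fs ! i \<in> arrows C (xs ! Suc i) (xs ! i))}"

definition str_obj :: "('o, 'm) string \<Rightarrow> nat \<Rightarrow> 'o" where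
  "str_obj \<phi> i = fst \<phi> ! i"

text \<open>The composite arrow from \<open>x\<^sub>l\<close> to \<open>x\<^sub>k\<close>, for \<open>k \<le> l\<close>.\<close>

definition str_arr :: "('o, 'm) cat \<Rightarrow> ('o, 'm) string \<Rightarrow> nat \<Rightarrow> nat \<Rightarrow> 'm" where
  "str_arr C \<phi> k l = foldr (Cmp C) (map (\<lambda>i. snd \<phi> ! i) [k..<l]) (Idt C (str_obj \<phi> l))"

definition str_pull :: "('o, 'm) cat \<Rightarrow> nat \<Rightarrow> (nat \<Rightarrow> nat) \<Rightarrow> ('o, 'm) string \<Rightarrow> ('o, 'm) string" where
  "str_pull C p \<zeta> \<phi> =
     (map (\<lambda>i. str_obj \<phi> (\<zeta> i)) [0..<Suc p], map (\<lambda>i. str_arr C \<phi> (\<zeta> i) (\<zeta> (Suc i))) [0..<p])"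

definition tuples :: "('k, 'v) module \<Rightarrow> nat \<Rightarrow> 'v list set" where
  "tuples V q = {vs. length vs = q \<and> set vs \<subseteq> carrier V}"

text \<open>Linear maps from the \<open>q\<close>-th tensor power of \<open>V\<close> to \<open>W\<close>, as multilinear maps of \<open>q\<close> arguments
  (for \<open>q = 0\<close>: elements of \<open>W\<close>).\<close>

definition multilinear_maps ::
    "('k, 'r) ring_scheme \<Rightarrow> ('k, 'v) module \<Rightarrow> nat \<Rightarrow> ('k, 'w) module \<Rightarrow> ('v list \<Rightarrow> 'w) set" where
  "multilinear_maps K V q W = {g \<in> tuples V q \<rightarrow>\<^sub>E carrier W.
     \<forall>vs\<in>tuples V q. \<forall>i<q. (\<lambda>x. g (vs[i := x])) \<in> linear_maps K V W}"

type_synonym ('o, 'm, 'v) cochain = "('o, 'm) string \<Rightarrow> 'v list \<Rightarrow> 'v"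

text \<open>The vector space of cochains of bidegree \<open>(p, q)\<close>.  Library modules extend rings; their
  multiplicative fields play no role.\<close>

definition cochains ::
    "('k, 'r) ring_scheme \<Rightarrow> ('o, 'm) cat \<Rightarrow> ('o, 'm, 'k, 'v) vect_functor \<Rightarrow> nat \<Rightarrow> nat \<Rightarrow>
     ('k, ('o, 'm, 'v) cochain) module" where
  "cochains K C A p q =
     \<lparr>carrier = (\<Pi>\<^sub>E \<phi>\<in>strings C p.
        multilinear_maps K (FObj A (str_obj \<phi> p)) q (FObj A (str_obj \<phi> 0))),
      monoid.mult = undefined, one = undefined,
      zero = (\<lambda>\<phi>\<in>strings C p. \<lambda>vs\<in>tuples (FObj A (str_obj \<phi> p)) q. \<zero>\<^bsub>FObj A (str_obj \<phi> 0)\<^esub>),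
      add = (\<lambda>f g. \<lambda>\<phi>\<in>strings C p. \<lambda>vs\<in>tuples (FObj A (str_obj \<phi> p)) q.
        f \<phi> vs \<oplus>\<^bsub>FObj A (str_obj \<phi> 0)\<^esub> g \<phi> vs),
      smult = (\<lambda>c f. \<lambda>\<phi>\<in>strings C p. \<lambda>vs\<in>tuples (FObj A (str_obj \<phi> p)) q.
        c \<odot>\<^bsub>FObj A (str_obj \<phi> 0)\<^esub> f \<phi> vs)\<rparr>"

text \<open>The direct sum of all bidegrees.  A component \<open>(p, q)\<close> has shifted bidegree \<open>(p, q - 1)\<close>; the
  shift relabels the components and is otherwise accounted for by the signs of the operations.\<close>

type_synonym ('o, 'm, 'v) total_cochain = "nat \<times> nat \<Rightarrow> ('o, 'm, 'v) cochain"

definition support ::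
    "('k, 'r) ring_scheme \<Rightarrow> ('o, 'm) cat \<Rightarrow> ('o, 'm, 'k, 'v) vect_functor \<Rightarrow>
     ('o, 'm, 'v) total_cochain \<Rightarrow> (nat \<times> nat) set" where
  "support K C A F = {(p, q). F (p, q) \<noteq> \<zero>\<^bsub>cochains K C A p q\<^esub>}"

definition total_cochains ::
    "('k, 'r) ring_scheme \<Rightarrow> ('o, 'm) cat \<Rightarrow> ('o, 'm, 'k, 'v) vect_functor \<Rightarrow>
     ('k, ('o, 'm, 'v) total_cochain) module" where
  "total_cochains K C A =
     \<lparr>carrier = {F. (\<forall>p q. F (p, q) \<in> carrier (cochains K C A p q)) \<and> finite (support K C A F)},
      monoid.mult = undefined, one = undefined,
      zero = (\<lambda>(p, q). \<zero>\<^bsub>cochains K C A p q\<^esub>),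
      add = (\<lambda>F G. \<lambda>(p, q). F (p, q) \<oplus>\<^bsub>cochains K C A p q\<^esub> G (p, q)),
      smult = (\<lambda>c F. \<lambda>(p, q). c \<odot>\<^bsub>cochains K C A p q\<^esub> F (p, q))\<rparr>"

definition homogeneous ::
    "('k, 'r) ring_scheme \<Rightarrow> ('o, 'm) cat \<Rightarrow> ('o, 'm, 'k, 'v) vect_functor \<Rightarrow> nat \<Rightarrow> nat \<Rightarrow>
     ('o, 'm, 'v) cochain \<Rightarrow> ('o, 'm, 'v) total_cochain" where
  "homogeneous K C A p q f = (\<zero>\<^bsub>total_cochains K C A\<^esub>)((p, q) := f)"

definition asimplicial ::
    "('k, 'r) ring_scheme \<Rightarrow> ('o, 'm) cat \<Rightarrow> ('o, 'm, 'k, 'v) vect_functor \<Rightarrow>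
     ('o, 'm, 'v) total_cochain set" where
  "asimplicial K C A =
     {F \<in> carrier (total_cochains K C A). \<forall>(p, q)\<in>support K C A F. 0 \<le> p \<and> 1 \<le> q}"

definition coface :: "nat \<Rightarrow> nat \<Rightarrow> nat" where
  "coface i j = (if j < i then j else Suc j)"

definition delta_face ::
    "('o, 'm) cat \<Rightarrow> ('o, 'm, 'k, 'v) vect_functor \<Rightarrow> nat \<Rightarrow> nat \<Rightarrow> nat \<Rightarrow>
     ('o, 'm, 'v) cochain \<Rightarrow> ('o, 'm, 'v) cochain" where
  "delta_face C A p q i f =
     (\<lambda>\<phi>\<in>strings C (Suc p). \<lambda>vs\<in>tuples (FObj A (str_obj \<phi> (Suc p))) q.
        FArr A (str_arr C \<phi> 0 (coface i 0))
          (f (str_pull C p (coface i) \<phi>)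
            (map (FArr A (str_arr C \<phi> (coface i p) (Suc p))) vs)))"

definition delta_bidegree ::
    "('k, 'r) ring_scheme \<Rightarrow> ('o, 'm) cat \<Rightarrow> ('o, 'm, 'k, 'v) vect_functor \<Rightarrow> nat \<Rightarrow> nat \<Rightarrow>
     ('o, 'm, 'v) cochain \<Rightarrow> ('o, 'm, 'v) cochain" where
  "delta_bidegree K C A p q f =
     (\<Oplus>\<^bsub>cochains K C A (Suc p) q\<^esub> i\<in>{0..Suc p}.
        [((- 1 :: int) ^ i)] \<cdot>\<^bsub>cochains K C A (Suc p) q\<^esub> delta_face C A p q i f)"

definition delta_S ::
    "('k, 'r) ring_scheme \<Rightarrow> ('o, 'm) cat \<Rightarrow> ('o, 'm, 'k, 'v) vect_functor \<Rightarrow>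
     ('o, 'm, 'v) total_cochain \<Rightarrow> ('o, 'm, 'v) total_cochain" where
  "delta_S K C A F = (\<lambda>(p, q). case p of
       0 \<Rightarrow> \<zero>\<^bsub>cochains K C A 0 q\<^esub>
     | Suc p' \<Rightarrow> delta_bidegree K C A p' q (F (p', q)))"


section \<open>The action of quilts\<close>

text \<open>The child whose output is inserted in the \<open>i\<close>-th input of \<open>a\<close>.\<close>

definition child_at :: "nat planar_tree \<Rightarrow> (nat \<times> nat \<Rightarrow> nat) \<Rightarrow> nat \<Rightarrow> nat \<Rightarrow> nat option" where
  "child_at T I a i =
     (if \<exists>!b. (a, b) \<in> edges T \<and> I (a, b) = i
      then Some (THE b. (a, b) \<in> edges T \<and> I (a, b) = i) else None)"

lemma child_at_edge:
  assumes "child_at T I a i = Some b"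
  shows "(a, b) \<in> edges T"
proof -
  have ex: "\<exists>!b. (a, b) \<in> edges T \<and> I (a, b) = i" and b: "b = (THE b. (a, b) \<in> edges T \<and> I (a, b) = i)"
    using assms by (auto simp: child_at_def split: if_splits)
  show ?thesis
    using theI'[OF ex] b by simp
qed

text \<open>The inputs \<open>(a, i)\<close> of the vertices above a given vertex that are not used by an edge, in planar
  order.\<close>

function free_inputs ::
    "nat planar_tree \<Rightarrow> (nat \<Rightarrow> nat) \<Rightarrow> (nat \<times> nat \<Rightarrow> nat) \<Rightarrow> nat \<Rightarrow> (nat \<times> nat) list" where
  "free_inputs T q I a =
     (if is_tree T then
        concat (map (\<lambda>i. case child_at T I a i of
            None \<Rightarrow> [(a, i)]
          | Some b \<Rightarrow> free_inputs T q I b) [1..<Suc (q a)])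
      else [])"
  by auto
termination
  by (relation "measure (\<lambda>(T, q, I, a). card (descendants T a))")
    (auto simp: child_at_edge card_descendants_less)

declare free_inputs.simps [simp del]

text \<open>The composite along the tree starting at a vertex \<open>a\<close>, where \<open>node a\<close> is the operation at \<open>a\<close>,
  \<open>edge a b\<close> is applied to the output of \<open>b\<close> before it is inserted in \<open>a\<close>, \<open>leaf a\<close> is applied to the
  free inputs of \<open>a\<close>, and \<open>u\<close> assigns values to the free inputs.\<close>

function tree_composite ::
    "nat planar_tree \<Rightarrow> (nat \<Rightarrow> nat) \<Rightarrow> (nat \<times> nat \<Rightarrow> nat) \<Rightarrow> (nat \<Rightarrow> 'v list \<Rightarrow> 'v) \<Rightarrow>
     (nat \<Rightarrow> nat \<Rightarrow> 'v \<Rightarrow> 'v) \<Rightarrow> (nat \<Rightarrow> 'v \<Rightarrow> 'v) \<Rightarrow> (nat \<times> nat \<Rightarrow> 'v) \<Rightarrow> nat \<Rightarrow> 'v" where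
  "tree_composite T q I node edge leaf u a =
     (if is_tree T then
        node a (map (\<lambda>i. case child_at T I a i of
            None \<Rightarrow> leaf a (u (a, i))
          | Some b \<Rightarrow> edge a b (tree_composite T q I node edge leaf u b)) [1..<Suc (q a)])
      else undefined)"
  by auto
termination
  by (relation "measure (\<lambda>(T, q, I, node, edge, leaf, u, a). card (descendants T a))")
    (auto simp: child_at_edge card_descendants_less)

declare tree_composite.simps [simp del]

definition coloring_action ::
    "('o, 'm) cat \<Rightarrow> ('o, 'm, 'k, 'v) vect_functor \<Rightarrow> nat \<Rightarrow> nat list \<Rightarrow> nat planar_tree \<Rightarrow>
     (nat \<Rightarrow> nat) \<Rightarrow> (nat \<Rightarrow> nat) \<Rightarrow> (nat \<Rightarrow> nat \<Rightarrow> nat) \<Rightarrow> (nat \<times> nat \<Rightarrow> nat) \<Rightarrow>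
     (nat \<Rightarrow> ('o, 'm, 'v) cochain) \<Rightarrow> ('o, 'm, 'v) cochain" where
  "coloring_action C A n W T p q \<zeta> I f =
     (let p' = out_p n W p; r = tree_root T in
      (\<lambda>\<phi>\<in>strings C p'. \<lambda>vs\<in>tuples (FObj A (str_obj \<phi> p')) (out_q n q).
        FArr A (str_arr C \<phi> 0 (\<zeta> r 0))
          (tree_composite T q I
            (\<lambda>a. f a (str_pull C (p a) (\<zeta> a) \<phi>))
            (\<lambda>a b. FArr A (str_arr C \<phi> (\<zeta> a (p a)) (\<zeta> b 0)))
            (\<lambda>a. FArr A (str_arr C \<phi> (\<zeta> a (p a)) p'))
            (\<lambda>x. the (map_of (zip (free_inputs T q I r) vs) x))
            r)))"

definition quilt_op_bidegree ::
    "('k, 'r) ring_scheme \<Rightarrow> ('o, 'm) cat \<Rightarrow> ('o, 'm, 'k, 'v) vect_functor \<Rightarrow> nat \<Rightarrow>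
     nat list \<times> nat planar_tree \<Rightarrow> (nat \<Rightarrow> nat) \<Rightarrow> (nat \<Rightarrow> nat) \<Rightarrow>
     (nat \<Rightarrow> ('o, 'm, 'v) cochain) \<Rightarrow> ('o, 'm, 'v) cochain" where
  "quilt_op_bidegree K C A n Q p q f =
     (let (W, T) = Q; M = cochains K C A (out_p n W p) (out_q n q) in
      \<Oplus>\<^bsub>M\<^esub> \<zeta>\<in>word_colorings n W p. \<Oplus>\<^bsub>M\<^esub> I\<in>tree_colorings T q.
        [quilt_sign n W T p q \<zeta> I] \<cdot>\<^bsub>M\<^esub> coloring_action C A n W T p q \<zeta> I f)"

text \<open>The multilinear extension to the direct sum: \<open>d a\<close> is the bidegree of the component taken from
  the \<open>a\<close>-th argument.\<close>

definition quilt_op ::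
    "('k, 'r) ring_scheme \<Rightarrow> ('o, 'm) cat \<Rightarrow> ('o, 'm, 'k, 'v) vect_functor \<Rightarrow> nat \<Rightarrow>
     nat list \<times> nat planar_tree \<Rightarrow> (nat \<Rightarrow> ('o, 'm, 'v) total_cochain) \<Rightarrow>
     ('o, 'm, 'v) total_cochain" where
  "quilt_op K C A n Q F =
     (\<Oplus>\<^bsub>total_cochains K C A\<^esub> d\<in>(\<Pi>\<^sub>E a\<in>{1..n}. support K C A (F a)).
        homogeneous K C A (out_p n (fst Q) (\<lambda>a. fst (d a))) (out_q n (\<lambda>a. snd (d a)))
          (quilt_op_bidegree K C A n Q (\<lambda>a. fst (d a)) (\<lambda>a. snd (d a)) (\<lambda>a. F a (d a))))"

definition subcomplex ::
    "('k, 'r) ring_scheme \<Rightarrow> ('o, 'm) cat \<Rightarrow> ('o, 'm, 'k, 'v) vect_functor \<Rightarrow>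
     ('o, 'm, 'v) total_cochain set \<Rightarrow> bool" where
  "subcomplex K C A S \<longleftrightarrow>
     submodule S K (total_cochains K C A) \<and>
     (\<forall>F\<in>S. \<forall>p q. homogeneous K C A p q (F (p, q)) \<in> S) \<and>
     (\<forall>F\<in>S. delta_S K C A F \<in> S)"

definition quilt_subalgebra ::
    "('k, 'r) ring_scheme \<Rightarrow> ('o, 'm) cat \<Rightarrow> ('o, 'm, 'k, 'v) vect_functor \<Rightarrow>
     ('o, 'm, 'v) total_cochain set \<Rightarrow> bool" where
  "quilt_subalgebra K C A S \<longleftrightarrow>
     subcomplex K C A S \<and>
     (\<forall>n. \<forall>Q\<in>Quilt n. \<forall>F. (\<forall>a\<in>{1..n}. F a \<in> S) \<longrightarrow> quilt_op K C A n Q F \<in> S)"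

end

theory Submission
  imports Defs
begin

text \<open>The differential \<open>\<delta>\<^sup>S\<close> preserves \<open>q\<close>, and a quilt operation sends \<open>q\<^sub>1, \<dots>, q\<^sub>n\<close> to
  \<open>1 + \<Sum>\<^sub>a (q\<^sub>a - 1)\<close>, which is at least 1 when every \<open>q\<^sub>a\<close> is.  The signs play no role.  What remains is that
  each coloring really yields a cochain: on an edge \<open>(a, b)\<close> every occurrence of \<open>a\<close> in the word precedes
  every occurrence of \<open>b\<close>, so the arrow between the two vertices exists; each free input is reached
  through exactly one input of every vertex below it, so the composite is multilinear; and a tree with
  \<open>n\<close> vertices has \<open>n - 1\<close> edges, so the number of free inputs is the expected one.\<close>

section \<open>Products of modules\<close>

text \<open>Cochains are such products; multilinear maps and the direct sum over bidegrees are
  obtained from them by shrinking the carrier. The multiplicative fields are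
  \<open>undefined\<close> to agree as records with \<open>cochains\<close> and
  \<open>total_cochains\<close>.\<close>

definition prod_module :: "'i set \<Rightarrow> ('i \<Rightarrow> ('k, 'v) module) \<Rightarrow> ('k, 'i \<Rightarrow> 'v) module" where
  "prod_module I M =
     \<lparr>carrier = (\<Pi>\<^sub>E i\<in>I. carrier (M i)),
      monoid.mult = undefined, one = undefined,
      zero = (\<lambda>i\<in>I. \<zero>\<^bsub>M i\<^esub>),
      add = (\<lambda>f g. \<lambda>i\<in>I. f i \<oplus>\<^bsub>M i\<^esub> g i),
      smult = (\<lambda>c f. \<lambda>i\<in>I. c \<odot>\<^bsub>M i\<^esub> f i)\<rparr>"

lemma module_prod_module:
  assumes "cring K" and M: "\<And>i. i \<in> I \<Longrightarrow> module K (M i)"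
  shows "module K (prod_module I M)"
proof -
  let ?P = "prod_module I M"
  have ab: "abelian_group (M i)" if "i \<in> I" for i
    using M[OF that] by (rule module.axioms(2))
  have am: "abelian_monoid (M i)" if "i \<in> I" for i
    using ab[OF that] by (rule abelian_group.axioms(1))
  have mem: "x i \<in> carrier (M i)" if "x \<in> carrier ?P" "i \<in> I" for x i
    using that by (auto simp: prod_module_def)
  have add: "(x \<oplus>\<^bsub>?P\<^esub> y) i = x i \<oplus>\<^bsub>M i\<^esub> y i" if "i \<in> I" for x y i
    using that by (simp add: prod_module_def)
  have smult: "(c \<odot>\<^bsub>?P\<^esub> x) i = c \<odot>\<^bsub>M i\<^esub> x i" if "i \<in> I" for c x i
    using that by (simp add: prod_module_def)
  have zero: "\<zero>\<^bsub>?P\<^esub> i = \<zero>\<^bsub>M i\<^esub>" if "i \<in> I" for i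
    using that by (simp add: prod_module_def)
  have add_closed: "x \<oplus>\<^bsub>?P\<^esub> y \<in> carrier ?P" if "x \<in> carrier ?P" "y \<in> carrier ?P" for x y
    using that by (auto simp: prod_module_def intro!: abelian_monoid.a_closed[OF am])
  have smult_closed: "c \<odot>\<^bsub>?P\<^esub> x \<in> carrier ?P" if "c \<in> carrier K" "x \<in> carrier ?P" for c x
    using that by (auto simp: prod_module_def intro!: module.smult_closed[OF M])
  have zero_closed: "\<zero>\<^bsub>?P\<^esub> \<in> carrier ?P"
    by (auto simp: prod_module_def intro!: abelian_monoid.zero_closed[OF am])
  have eqI: "x = y" if "x \<in> carrier ?P" "y \<in> carrier ?P" "\<And>i. i \<in> I \<Longrightarrow> x i = y i" for x y
    using that(1,2) by (intro PiE_ext[of x I "\<lambda>i. carrier (M i)"] that(3)) (simp_all add: prod_module_def)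
  note closed = add_closed smult_closed zero_closed
  note comp = add smult zero
  show ?thesis
  proof (rule moduleI)
    show "abelian_group ?P"
    proof (rule abelian_groupI)
      fix x assume x: "x \<in> carrier ?P"
      define y where "y = (\<lambda>i\<in>I. \<ominus>\<^bsub>M i\<^esub> x i)"
      have y: "y \<in> carrier ?P"
        using x by (auto simp: y_def prod_module_def intro!: abelian_group.a_inv_closed[OF ab])
      have "y \<oplus>\<^bsub>?P\<^esub> x = \<zero>\<^bsub>?P\<^esub>"
      proof (rule eqI)
        show "(y \<oplus>\<^bsub>?P\<^esub> x) i = \<zero>\<^bsub>?P\<^esub> i" if "i \<in> I" for i
          using that abelian_group.l_neg[OF ab[OF that] mem[OF x that]] by (simp add: comp y_def)
      qed (use x y closed in auto)
      then show "\<exists>y\<in>carrier ?P. y \<oplus>\<^bsub>?P\<^esub> x = \<zero>\<^bsub>?P\<^esub>"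
        using y by blast
    qed (auto intro!: eqI closed simp: comp mem abelian_monoid.a_assoc[OF am]
        abelian_monoid.l_zero[OF am] abelian_monoid.a_comm[OF am])
  next
    fix a b x y
    assume a: "a \<in> carrier K" and b: "b \<in> carrier K" and x: "x \<in> carrier ?P" and y: "y \<in> carrier ?P"
    interpret K: cring K by fact
    show "(a \<oplus>\<^bsub>K\<^esub> b) \<odot>\<^bsub>?P\<^esub> x = a \<odot>\<^bsub>?P\<^esub> x \<oplus>\<^bsub>?P\<^esub> b \<odot>\<^bsub>?P\<^esub> x"
      by (intro eqI closed a b x K.a_closed) (simp add: comp a b x mem module.smult_l_distr[OF M])
    show "a \<odot>\<^bsub>?P\<^esub> (x \<oplus>\<^bsub>?P\<^esub> y) = a \<odot>\<^bsub>?P\<^esub> x \<oplus>\<^bsub>?P\<^esub> a \<odot>\<^bsub>?P\<^esub> y"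
      by (intro eqI closed a x y) (simp add: comp a x y mem module.smult_r_distr[OF M])
    show "(a \<otimes>\<^bsub>K\<^esub> b) \<odot>\<^bsub>?P\<^esub> x = a \<odot>\<^bsub>?P\<^esub> (b \<odot>\<^bsub>?P\<^esub> x)"
      by (intro eqI closed a b x K.m_closed) (simp add: comp a b x mem module.smult_assoc1[OF M])
  next
    fix x assume x: "x \<in> carrier ?P"
    interpret K: cring K by fact
    show "\<one>\<^bsub>K\<^esub> \<odot>\<^bsub>?P\<^esub> x = x"
      by (intro eqI closed x K.one_closed) (simp add: comp x mem module.smult_one[OF M])
  qed (use assms closed in auto)
qed


section \<open>Linear and multilinear maps\<close>

lemma linear_maps_closed: "h \<in> linear_maps K V W \<Longrightarrow> x \<in> carrier V \<Longrightarrow> h x \<in> carrier W"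
  by (auto simp: linear_maps_def)

text \<open>\<open>linear_maps\<close> demands additivity and homogeneity only; zero is preserved
  because it is its own multiple by the scalar 0.\<close>

lemma linear_maps_zero:
  assumes "module K V" "module K W" and h: "h \<in> linear_maps K V W"
  shows "h \<zero>\<^bsub>V\<^esub> = \<zero>\<^bsub>W\<^esub>"
proof -
  interpret V: module K V by fact
  interpret W: module K W by fact
  have "h (\<zero>\<^bsub>K\<^esub> \<odot>\<^bsub>V\<^esub> \<zero>\<^bsub>V\<^esub>) = \<zero>\<^bsub>K\<^esub> \<odot>\<^bsub>W\<^esub> h \<zero>\<^bsub>V\<^esub>"
    using h V.R.zero_closed V.zero_closed by (simp add: linear_maps_def del: V.smult_r_null V.smult_l_null)
  then show ?thesis
    using linear_maps_closed[OF h V.zero_closed] by simp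
qed

text \<open>Elements of \<open>linear_maps\<close> are not extensional, so only values on the
  carrier count. This removes \<open>restrict\<close> from the body of a multilinear map.\<close>

lemma linear_maps_cong:
  assumes "module K V" and "\<And>x. x \<in> carrier V \<Longrightarrow> h x = h' x"
  shows "h \<in> linear_maps K V W \<longleftrightarrow> h' \<in> linear_maps K V W"
proof -
  interpret V: module K V by fact
  show ?thesis
    using assms(2) by (simp add: linear_maps_def Pi_iff)
qed

lemma linear_maps_compose:
  "g \<in> linear_maps K U V \<Longrightarrow> h \<in> linear_maps K V W \<Longrightarrow> (\<lambda>x. h (g x)) \<in> linear_maps K U W"
  by (auto simp: linear_maps_def Pi_iff)

lemma linear_maps_const_zero:
  assumes "module K W"
  shows "(\<lambda>x. \<zero>\<^bsub>W\<^esub>) \<in> linear_maps K V W"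
proof -
  interpret W: module K W by fact
  show ?thesis by (simp add: linear_maps_def)
qed

lemma linear_maps_add:
  assumes "module K W" and g: "g \<in> linear_maps K V W" and h: "h \<in> linear_maps K V W"
  shows "(\<lambda>x. g x \<oplus>\<^bsub>W\<^esub> h x) \<in> linear_maps K V W"
proof -
  interpret W: module K W by fact
  show ?thesis using g h by (auto simp: linear_maps_def Pi_iff W.smult_r_distr W.a_ac)
qed

lemma linear_maps_smult:
  assumes "module K W" and c: "c \<in> carrier K" and g: "g \<in> linear_maps K V W"
  shows "(\<lambda>x. c \<odot>\<^bsub>W\<^esub> g x) \<in> linear_maps K V W"
proof -
  interpret W: module K W by fact
  \<comment> \<open>Here commutativity of the scalars enters.\<close>
  have "c \<odot>\<^bsub>W\<^esub> (d \<odot>\<^bsub>W\<^esub> x) = d \<odot>\<^bsub>W\<^esub> (c \<odot>\<^bsub>W\<^esub> x)" if "d \<in> carrier K" "x \<in> carrier W" for d x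
    using that c W.R.m_comm[of c d] by (simp flip: W.smult_assoc1)
  then show ?thesis
    using g c by (simp add: linear_maps_def Pi_iff W.smult_r_distr)
qed

lemma tuples_update: "vs \<in> tuples V q \<Longrightarrow> x \<in> carrier V \<Longrightarrow> vs[i := x] \<in> tuples V q"
  by (auto simp: tuples_def dest: set_update_subset_insert[THEN subsetD])

lemma multilinear_mapsD:
  assumes "g \<in> multilinear_maps K V q W"
  shows "vs \<in> tuples V q \<Longrightarrow> g vs \<in> carrier W"
    and "vs \<in> tuples V q \<Longrightarrow> i < q \<Longrightarrow> (\<lambda>x. g (vs[i := x])) \<in> linear_maps K V W"
  using assms by (auto simp: multilinear_maps_def)

text \<open>Changing one entry within the carrier stays inside \<open>tuples\<close>, so the
  restriction is invisible to linearity in each argument.\<close>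

lemma multilinear_mapsI:
  assumes "module K V"
    and "\<And>vs. vs \<in> tuples V q \<Longrightarrow> g vs \<in> carrier W"
    and "\<And>vs i. vs \<in> tuples V q \<Longrightarrow> i < q \<Longrightarrow> (\<lambda>x. g (vs[i := x])) \<in> linear_maps K V W"
  shows "(\<lambda>vs\<in>tuples V q. g vs) \<in> multilinear_maps K V q W"
proof -
  have "(\<lambda>x. (\<lambda>vs\<in>tuples V q. g vs) (vs[i := x])) \<in> linear_maps K V W"
    if "vs \<in> tuples V q" "i < q" for vs i
    using assms(3)[OF that] that
    by (subst linear_maps_cong[OF assms(1)]) (auto simp: tuples_update)
  then show ?thesis
    using assms(2) by (auto simp: multilinear_maps_def)
qed

lemma map_in_tuples:
  "g \<in> linear_maps K V W \<Longrightarrow> vs \<in> tuples V q \<Longrightarrow> map g vs \<in> tuples W q"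
  by (auto simp: tuples_def linear_maps_def)

text \<open>Mapping \<open>g\<close> over a tuple commutes with changing one entry, so in each
  argument the map is a composite of three linear maps.\<close>

lemma multilinear_maps_compose:
  assumes "module K V'" and f: "f \<in> multilinear_maps K V q W"
    and g: "g \<in> linear_maps K V' V" and h: "h \<in> linear_maps K W W'"
  shows "(\<lambda>vs\<in>tuples V' q. h (f (map g vs))) \<in> multilinear_maps K V' q W'"
proof (rule multilinear_mapsI[OF assms(1)])
  fix vs assume vs: "vs \<in> tuples V' q"
  note m = map_in_tuples[OF g vs]
  show "h (f (map g vs)) \<in> carrier W'"
    by (intro linear_maps_closed[OF h] multilinear_mapsD(1)[OF f] m)
  fix i assume "i < q"
  have "(\<lambda>x. h (f ((map g vs)[i := g x]))) \<in> linear_maps K V' W'"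
    by (rule linear_maps_compose[OF _ h])
      (rule linear_maps_compose[OF g multilinear_mapsD(2)[OF f m \<open>i < q\<close>]])
  then show "(\<lambda>x. h (f (map g (vs[i := x])))) \<in> linear_maps K V' W'"
    by (simp add: map_update)
qed

section \<open>The module of multilinear maps\<close>

definition multilinear_module ::
    "('k, 'r) ring_scheme \<Rightarrow> ('k, 'v) module \<Rightarrow> nat \<Rightarrow> ('k, 'w) module \<Rightarrow> ('k, 'v list \<Rightarrow> 'w) module"
  where "multilinear_module K V q W =
    (prod_module (tuples V q) (\<lambda>_. W))\<lparr>carrier := multilinear_maps K V q W\<rparr>"

text \<open>Negation is multiplication by -1, so zero, sums and multiples are all that is left to
  check.\<close>

lemma (in module) submoduleI':
  assumes "H \<subseteq> carrier M" and "\<zero>\<^bsub>M\<^esub> \<in> H"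
    and "\<And>a b. a \<in> H \<Longrightarrow> b \<in> H \<Longrightarrow> a \<oplus>\<^bsub>M\<^esub> b \<in> H"
    and smult: "\<And>a x. a \<in> carrier R \<Longrightarrow> x \<in> H \<Longrightarrow> a \<odot>\<^bsub>M\<^esub> x \<in> H"
  shows "submodule H R M"
proof (rule submoduleI)
  fix x assume "x \<in> H"
  moreover from this have "\<ominus>\<^bsub>M\<^esub> x = (\<ominus> \<one>) \<odot>\<^bsub>M\<^esub> x"
    using assms(1) by (subst smult_l_minus) auto
  ultimately show "\<ominus>\<^bsub>M\<^esub> x \<in> H"
    using smult by simp
qed (use assms in auto)

text \<open>Induction on the index set; for an infinite one \<open>finsum\<close> is zero, which
  lies in \<open>H\<close>.\<close>

lemma (in module) submodule_finsum_closed: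
  assumes "submodule H R M" and "f \<in> S \<rightarrow> H"
  shows "finsum M f S \<in> H"
proof -
  interpret H: submodule H R M by fact
  \<comment> \<open>A \<open>submodule\<close> is a subgroup of the additive monoid written
    multiplicatively, so \<open>one_closed\<close> is about zero.\<close>
  have sub: "H \<subseteq> carrier M" and zero: "\<zero>\<^bsub>M\<^esub> \<in> H"
    using H.subset H.one_closed by simp_all
  show ?thesis
    using assms(2)
  proof (induction S rule: infinite_finite_induct)
    case (insert x S)
    then have "finsum M f (insert x S) = f x \<oplus>\<^bsub>M\<^esub> finsum M f S"
      using sub by (intro M.finsum_insert) auto
    then show ?case
      using insert submoduleE(5)[OF assms(1)] by simp
  qed (simp_all add: zero)
qed

text \<open>Pointwise zero, sums and multiples stay linear in each argument, so multilinear maps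
  form a submodule of the product of copies of \<open>W\<close> indexed by all tuples.\<close>

lemma module_multilinear_module:
  assumes "module K V" and W: "module K W"
  shows "module K (multilinear_module K V q W)"
proof -
  let ?P = "prod_module (tuples V q) (\<lambda>_. W)"
  interpret P: module K ?P
    using W by (intro module_prod_module) (auto dest: module.axioms(1))
  interpret W: module K W by fact
  have "submodule (multilinear_maps K V q W) K ?P"
  proof (rule P.submoduleI')
    show "multilinear_maps K V q W \<subseteq> carrier ?P"
      by (auto simp: multilinear_maps_def prod_module_def)
    show "\<zero>\<^bsub>?P\<^esub> \<in> multilinear_maps K V q W"
      unfolding prod_module_def ring.simps
      by (intro multilinear_mapsI assms linear_maps_const_zero W.zero_closed)
    show "f \<oplus>\<^bsub>?P\<^esub> g \<in> multilinear_maps K V q W"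
      if "f \<in> multilinear_maps K V q W" "g \<in> multilinear_maps K V q W" for f g
      unfolding prod_module_def ring.simps
      using that by (intro multilinear_mapsI assms linear_maps_add W.a_closed multilinear_mapsD)
    show "c \<odot>\<^bsub>?P\<^esub> f \<in> multilinear_maps K V q W"
      if "c \<in> carrier K" "f \<in> multilinear_maps K V q W" for c f
      unfolding prod_module_def module.simps
      using that by (intro multilinear_mapsI assms linear_maps_smult W.smult_closed multilinear_mapsD)
  qed
  from submodule.submodule_is_module[OF this P.module_axioms] show ?thesis
    by (simp add: multilinear_module_def)
qed


section \<open>Strings\<close>

lemma strings_Obj: "\<phi> \<in> strings C p \<Longrightarrow> i \<le> p \<Longrightarrow> str_obj \<phi> i \<in> Obj C"
  by (auto simp: strings_def str_obj_def)

context small_category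
begin

text \<open>Downward induction on \<open>k\<close>, following the \<open>foldr\<close> in
  \<open>str_arr\<close>: it starts from the identity at position \<open>l\<close>, and each step
  composes one more arrow on the left.\<close>

lemma str_arr_in_arrows:
  assumes \<phi>: "\<phi> \<in> strings C p" and "k \<le> l" "l \<le> p"
  shows "str_arr C \<phi> k l \<in> arrows C (str_obj \<phi> l) (str_obj \<phi> k)"
  using \<open>k \<le> l\<close>
proof (induction rule: inc_induct)
  case base
  show ?case
    using Idt_in[OF strings_Obj[OF \<phi> \<open>l \<le> p\<close>]] by (simp add: str_arr_def)
next
  case (step k)
  have "snd \<phi> ! k \<in> arrows C (str_obj \<phi> (Suc k)) (str_obj \<phi> k)"
    using \<phi> step.hyps \<open>l \<le> p\<close> by (auto simp: strings_def str_obj_def)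
  then have "Cmp C (snd \<phi> ! k) (str_arr C \<phi> (Suc k) l) \<in> arrows C (str_obj \<phi> l) (str_obj \<phi> k)"
    by (rule Cmp_in[OF step.IH])
  then show ?case
    using step.hyps by (simp add: str_arr_def upt_conv_Cons)
qed

text \<open>Monotonicity puts consecutive positions in the order in which \<open>str_arr\<close> is
  an arrow. In this form the lemma serves both cofaces and colorings.\<close>

lemma str_pull_in_strings:
  assumes \<phi>: "\<phi> \<in> strings C p'" and \<zeta>: "mono_on {0..p} \<zeta>" "\<zeta> p \<le> p'"
  shows "str_pull C p \<zeta> \<phi> \<in> strings C p"
proof -
  have le: "\<zeta> i \<le> \<zeta> j" if "i \<le> j" "j \<le> p" for i j
    using monotone_onD[OF \<zeta>(1), of i j] that by simp
  have le': "\<zeta> i \<le> p'" if "i \<le> p" for i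
    using le[of i p] that \<zeta>(2) by simp
  have o: "str_obj \<phi> (\<zeta> i) \<in> Obj C" if "i \<le> p" for i
    using le'[OF that] strings_Obj[OF \<phi>] by blast
  have a: "str_arr C \<phi> (\<zeta> i) (\<zeta> (Suc i)) \<in> arrows C (str_obj \<phi> (\<zeta> (Suc i))) (str_obj \<phi> (\<zeta> i))"
    if "i < p" for i
    using that by (intro str_arr_in_arrows[OF \<phi>] le le') auto
  show ?thesis
    using o a by (auto simp: strings_def str_pull_def less_Suc_eq_le nth_append simp del: upt_Suc)
qed

end

lemma str_obj_str_pull: "i \<le> p \<Longrightarrow> str_obj (str_pull C p \<zeta> \<phi>) i = str_obj \<phi> (\<zeta> i)"
  by (simp add: str_obj_def str_pull_def less_Suc_eq_le del: upt_Suc)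


section \<open>Cochains\<close>

context functor_to_vect
begin

lemma module_str_obj: "\<phi> \<in> strings C p \<Longrightarrow> i \<le> p \<Longrightarrow> module K (FObj A (str_obj \<phi> i))"
  by (rule FObj_vector_space[OF strings_Obj])

lemma FArr_str_arr_linear:
  "\<phi> \<in> strings C p \<Longrightarrow> k \<le> l \<Longrightarrow> l \<le> p \<Longrightarrow>
    FArr A (str_arr C \<phi> k l) \<in> linear_maps K (FObj A (str_obj \<phi> l)) (FObj A (str_obj \<phi> k))"
  by (rule FArr_linear[OF str_arr_in_arrows])

lemma cochains_eq_prod_module:
  "cochains K C A p q = prod_module (strings C p)
     (\<lambda>\<phi>. multilinear_module K (FObj A (str_obj \<phi> p)) q (FObj A (str_obj \<phi> 0)))"
  by (simp add: cochains_def prod_module_def multilinear_module_def)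

lemma module_cochains: "module K (cochains K C A p q)"
  unfolding cochains_eq_prod_module
  by (intro module_prod_module module_multilinear_module module_str_obj is_cring) auto

lemma cochains_carrier_iff:
  "f \<in> carrier (cochains K C A p q) \<longleftrightarrow> f \<in> (\<Pi>\<^sub>E \<phi>\<in>strings C p.
     multilinear_maps K (FObj A (str_obj \<phi> p)) q (FObj A (str_obj \<phi> 0)))"
  by (simp add: cochains_def)

section \<open>The direct sum over all bidegrees\<close>

lemma total_cochains_eq_prod_module:
  "total_cochains K C A = (prod_module UNIV (\<lambda>(p, q). cochains K C A p q))
     \<lparr>carrier := {F. (\<forall>p q. F (p, q) \<in> carrier (cochains K C A p q)) \<and> finite (support K C A F)}\<rparr>"
  by (simp add: total_cochains_def prod_module_def fun_eq_iff split_def)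


lemma module_total_cochains_UNIV: "module K (prod_module UNIV (\<lambda>(p, q). cochains K C A p q))"
  by (intro module_prod_module is_cring) (auto simp: module_cochains)

lemma abelian_group_cochains: "abelian_group (cochains K C A p q)"
  using module_cochains by (rule module.axioms(2))

lemma total_cochains_add: "(F \<oplus>\<^bsub>total_cochains K C A\<^esub> G) (p, q) = F (p, q) \<oplus>\<^bsub>cochains K C A p q\<^esub> G (p, q)"
  and total_cochains_smult: "(c \<odot>\<^bsub>total_cochains K C A\<^esub> F) (p, q) = c \<odot>\<^bsub>cochains K C A p q\<^esub> F (p, q)"
  and total_cochains_zero: "\<zero>\<^bsub>total_cochains K C A\<^esub> (p, q) = \<zero>\<^bsub>cochains K C A p q\<^esub>"
  by (simp_all add: total_cochains_def)

lemma support_add: "support K C A (F \<oplus>\<^bsub>total_cochains K C A\<^esub> G) \<subseteq> support K C A F \<union> support K C A G"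
proof -
  have "\<zero>\<^bsub>cochains K C A p q\<^esub> \<oplus>\<^bsub>cochains K C A p q\<^esub> \<zero>\<^bsub>cochains K C A p q\<^esub> = \<zero>\<^bsub>cochains K C A p q\<^esub>" for p q
  proof -
    interpret M: module K "cochains K C A p q" by (rule module_cochains)
    show ?thesis by simp
  qed
  then show ?thesis
    by (auto simp: support_def total_cochains_add)
qed

lemma support_smult:
  assumes "c \<in> carrier K"
  shows "support K C A (c \<odot>\<^bsub>total_cochains K C A\<^esub> F) \<subseteq> support K C A F"
proof -
  have "c \<odot>\<^bsub>cochains K C A p q\<^esub> \<zero>\<^bsub>cochains K C A p q\<^esub> = \<zero>\<^bsub>cochains K C A p q\<^esub>" for p q
  proof -
    interpret M: module K "cochains K C A p q" by (rule module_cochains)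
    show ?thesis using assms by simp
  qed
  then show ?thesis
    by (auto simp: support_def total_cochains_smult)
qed

lemma support_zero: "support K C A \<zero>\<^bsub>total_cochains K C A\<^esub> = {}"
  by (auto simp: support_def total_cochains_zero)

lemma total_cochains_carrier:
  "F \<in> carrier (total_cochains K C A) \<longleftrightarrow>
     (\<forall>p q. F (p, q) \<in> carrier (cochains K C A p q)) \<and> finite (support K C A F)"
  by (simp add: total_cochains_def)

lemma total_cochains_add_closed:
  assumes "F \<in> carrier (total_cochains K C A)" "G \<in> carrier (total_cochains K C A)"
  shows "F \<oplus>\<^bsub>total_cochains K C A\<^esub> G \<in> carrier (total_cochains K C A)"
  using assms finite_subset[OF support_add[of F G]]
  by (simp add: total_cochains_carrier total_cochains_add abelian_monoid.a_closed
      abelian_group.axioms(1)[OF abelian_group_cochains])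

lemma total_cochains_smult_closed:
  assumes "c \<in> carrier K" "F \<in> carrier (total_cochains K C A)"
  shows "c \<odot>\<^bsub>total_cochains K C A\<^esub> F \<in> carrier (total_cochains K C A)"
  using assms finite_subset[OF support_smult[of c F]]
  by (simp add: total_cochains_carrier total_cochains_smult module.smult_closed[OF module_cochains])

lemma total_cochains_zero_closed: "\<zero>\<^bsub>total_cochains K C A\<^esub> \<in> carrier (total_cochains K C A)"
  by (simp add: total_cochains_carrier support_zero total_cochains_zero abelian_monoid.zero_closed
      abelian_group.axioms(1)[OF abelian_group_cochains])

text \<open>Families with finite support form a submodule of the full product: the support of a sum
  lies in the union of the supports, that of a multiple in the original one.\<close>

lemma module_total_cochains: "module K (total_cochains K C A)"
proof -
  let ?P = "prod_module UNIV (\<lambda>(p, q). cochains K C A p q)"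
  interpret P: module K ?P by (rule module_total_cochains_UNIV)
  let ?H = "carrier (total_cochains K C A)"
  have eq: "total_cochains K C A = ?P\<lparr>carrier := ?H\<rparr>"
    by (simp add: total_cochains_eq_prod_module)
  have ops: "\<zero>\<^bsub>?P\<^esub> = \<zero>\<^bsub>total_cochains K C A\<^esub>" "F \<oplus>\<^bsub>?P\<^esub> G = F \<oplus>\<^bsub>total_cochains K C A\<^esub> G"
    "c \<odot>\<^bsub>?P\<^esub> F = c \<odot>\<^bsub>total_cochains K C A\<^esub> F" for F G c
    by (simp_all add: total_cochains_eq_prod_module)
  have "submodule ?H K ?P"
  proof (rule P.submoduleI')
    show "?H \<subseteq> carrier ?P"
      by (auto simp: total_cochains_carrier prod_module_def)
  qed (simp_all add: ops total_cochains_add_closed total_cochains_smult_closed total_cochains_zero_closed)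
  from submodule.submodule_is_module[OF this P.module_axioms] show ?thesis
    by (simp flip: eq)
qed

section \<open>The asimplicial submodule\<close>

lemma asimplicial_iff:
  "F \<in> asimplicial K C A \<longleftrightarrow>
     F \<in> carrier (total_cochains K C A) \<and> (\<forall>x\<in>support K C A F. 1 \<le> snd x)"
  by (auto simp: asimplicial_def)

lemma asimplicial_submodule: "submodule (asimplicial K C A) K (total_cochains K C A)"
proof -
  interpret T: module K "total_cochains K C A" by (rule module_total_cochains)
  show ?thesis
  proof (rule T.submoduleI')
    show "F \<oplus>\<^bsub>total_cochains K C A\<^esub> G \<in> asimplicial K C A"
      if "F \<in> asimplicial K C A" "G \<in> asimplicial K C A" for F G
      using that support_add[of F G] by (auto simp: asimplicial_iff)
    show "c \<odot>\<^bsub>total_cochains K C A\<^esub> F \<in> asimplicial K C A"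
      if "c \<in> carrier K" "F \<in> asimplicial K C A" for c F
      using that support_smult[of c F] by (auto simp: asimplicial_iff)
  qed (auto simp: asimplicial_iff support_zero)
qed

text \<open>The second alternative is for the components with \<open>q = 0\<close> of an asimplicial
  element, which vanish.\<close>

lemma homogeneous_in_asimplicial:
  assumes f: "f \<in> carrier (cochains K C A p q)" and "1 \<le> q \<or> f = \<zero>\<^bsub>cochains K C A p q\<^esub>"
  shows "homogeneous K C A p q f \<in> asimplicial K C A"
proof -
  \<comment> \<open>With the bound built into the set, one inclusion gives both finiteness and the
    asimplicial condition.\<close>
  have sub: "support K C A (homogeneous K C A p q f) \<subseteq> {x. x = (p, q) \<and> 1 \<le> q}"
    using assms(2) by (auto simp: support_def homogeneous_def total_cochains_zero split: if_splits)
  moreover have "finite {x. x = (p, q) \<and> 1 \<le> q}"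
    by (rule finite_subset[of _ "{(p, q)}"]) auto
  ultimately have "finite (support K C A (homogeneous K C A p q f))"
    by (rule finite_subset)
  moreover have "homogeneous K C A p q f (p', q') \<in> carrier (cochains K C A p' q')" for p' q'
    using f total_cochains_zero_closed by (auto simp: homogeneous_def total_cochains_carrier)
  ultimately show ?thesis
    using sub by (auto simp: asimplicial_iff total_cochains_carrier)
qed

lemma asimplicial_homogeneous_component:
  assumes "F \<in> asimplicial K C A"
  shows "homogeneous K C A p q (F (p, q)) \<in> asimplicial K C A"
  using assms
  by (intro homogeneous_in_asimplicial) (fastforce simp: asimplicial_iff total_cochains_carrier support_def)+

section \<open>The simplicial differential\<close>

lemma coface_mono: "mono_on S (coface i)"
  by (auto simp: mono_on_def coface_def)

text \<open>A face is the component of \<open>f\<close> at the pulled-back string, between two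
  linear maps given by the functor on the arrows that join the end points of that string to those of
  \<open>\<phi>\<close>.\<close>

lemma delta_face_in_cochains:
  assumes f: "f \<in> carrier (cochains K C A p q)"
  shows "delta_face C A p q i f \<in> carrier (cochains K C A (Suc p) q)"
  unfolding cochains_carrier_iff delta_face_def
proof (rule restrict_PiE_iff[THEN iffD2], rule ballI)
  fix \<phi> assume \<phi>: "\<phi> \<in> strings C (Suc p)"
  have le: "coface i p \<le> Suc p" "coface i 0 \<le> Suc p"
    by (auto simp: coface_def)
  let ?\<psi> = "str_pull C p (coface i) \<phi>"
  have "?\<psi> \<in> strings C p"
    using le by (intro str_pull_in_strings[OF \<phi>] coface_mono)
  then have "f ?\<psi> \<in> multilinear_maps K (FObj A (str_obj ?\<psi> p)) q (FObj A (str_obj ?\<psi> 0))"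
    using f by (auto simp: cochains_carrier_iff)
  then show "(\<lambda>vs\<in>tuples (FObj A (str_obj \<phi> (Suc p))) q.
        FArr A (str_arr C \<phi> 0 (coface i 0))
          (f ?\<psi> (map (FArr A (str_arr C \<phi> (coface i p) (Suc p))) vs)))
      \<in> multilinear_maps K (FObj A (str_obj \<phi> (Suc p))) q (FObj A (str_obj \<phi> 0))"
    using le
    by (intro multilinear_maps_compose[where f = "f ?\<psi>"] module_str_obj[OF \<phi>])
      (auto simp: str_obj_str_pull intro!: FArr_str_arr_linear[OF \<phi>])
qed

text \<open>Needed to bound the support of the differential: a vanishing component of the argument
  contributes nothing.\<close>

lemma delta_face_zero:
  "delta_face C A p q i \<zero>\<^bsub>cochains K C A p q\<^esub> = \<zero>\<^bsub>cochains K C A (Suc p) q\<^esub>"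
  unfolding delta_face_def cochains_def ring.simps
proof (intro restrict_ext)
  fix \<phi> vs assume \<phi>: "\<phi> \<in> strings C (Suc p)" and vs: "vs \<in> tuples (FObj A (str_obj \<phi> (Suc p))) q"
  have le: "coface i p \<le> Suc p" "coface i 0 \<le> Suc p"
    by (auto simp: coface_def)
  let ?\<psi> = "str_pull C p (coface i) \<phi>"
  have \<psi>: "?\<psi> \<in> strings C p"
    using le by (intro str_pull_in_strings[OF \<phi>] coface_mono)
  let ?ws = "map (FArr A (str_arr C \<phi> (coface i p) (Suc p))) vs"
  have ws: "?ws \<in> tuples (FObj A (str_obj ?\<psi> p)) q"
    using le FArr_str_arr_linear[OF \<phi>] vs by (intro map_in_tuples) (auto simp: str_obj_str_pull)
  have "FArr A (str_arr C \<phi> 0 (coface i 0)) \<zero>\<^bsub>FObj A (str_obj ?\<psi> 0)\<^esub> = \<zero>\<^bsub>FObj A (str_obj \<phi> 0)\<^esub>"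
    using le by (intro linear_maps_zero)
      (auto simp: str_obj_str_pull intro!: FArr_str_arr_linear[OF \<phi>] FObj_vector_space strings_Obj[OF \<phi>])
  \<comment> \<open>The restricted zero cochain is \<open>undefined\<close> outside its domain, so
    its value is zero only because the string and the tuple lie in that domain.\<close>
  then show "FArr A (str_arr C \<phi> 0 (coface i 0))
      ((\<lambda>\<phi>\<in>strings C p. \<lambda>vs\<in>tuples (FObj A (str_obj \<phi> p)) q. \<zero>\<^bsub>FObj A (str_obj \<phi> 0)\<^esub>) ?\<psi> ?ws)
    = \<zero>\<^bsub>FObj A (str_obj \<phi> 0)\<^esub>"
    using \<psi> ws by simp
qed

lemma delta_bidegree_in_cochains:
  assumes "f \<in> carrier (cochains K C A p q)"
  shows "delta_bidegree K C A p q f \<in> carrier (cochains K C A (Suc p) q)"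
proof -
  interpret M: module K "cochains K C A (Suc p) q" by (rule module_cochains)
  show ?thesis
    unfolding delta_bidegree_def
    by (intro M.finsum_closed Pi_I M.add.int_pow_closed delta_face_in_cochains assms)
qed

lemma delta_bidegree_zero:
  "delta_bidegree K C A p q \<zero>\<^bsub>cochains K C A p q\<^esub> = \<zero>\<^bsub>cochains K C A (Suc p) q\<^esub>"
proof -
  interpret M: module K "cochains K C A (Suc p) q" by (rule module_cochains)
  show ?thesis
    unfolding delta_bidegree_def delta_face_zero by simp
qed

lemma delta_S_in_asimplicial:
  assumes F: "F \<in> asimplicial K C A"
  shows "delta_S K C A F \<in> asimplicial K C A"
proof -
  have F': "F (p, q) \<in> carrier (cochains K C A p q)" for p q
    using F by (simp add: asimplicial_iff total_cochains_carrier)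
  have zero: "\<zero>\<^bsub>cochains K C A p q\<^esub> \<in> carrier (cochains K C A p q)" for p q
    by (rule abelian_monoid.zero_closed[OF abelian_group.axioms(1)[OF abelian_group_cochains]])
  \<comment> \<open>Bidegrees with first entry 0 receive zero, the others receive zero unless the
    component one step below is nonzero. Finiteness and the bound on \<open>q\<close> are both read
    off from this.\<close>
  have sub: "support K C A (delta_S K C A F) \<subseteq> (\<lambda>(p, q). (Suc p, q)) ` support K C A F"
  proof
    fix x assume x: "x \<in> support K C A (delta_S K C A F)"
    obtain p q where pq: "x = (p, q)" by (cases x)
    show "x \<in> (\<lambda>(p, q). (Suc p, q)) ` support K C A F"
    proof (cases p)
      case 0
      then show ?thesis using x by (simp add: pq support_def delta_S_def)
    next
      case (Suc p')
      then have "(p', q) \<in> support K C A F"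
        using x by (auto simp: pq support_def delta_S_def delta_bidegree_zero)
      then show ?thesis
        using pq Suc by force
    qed
  qed
  have "delta_S K C A F (p, q) \<in> carrier (cochains K C A p q)" for p q
    by (cases p) (simp_all add: delta_S_def delta_bidegree_in_cochains F' zero)
  moreover have "finite (support K C A (delta_S K C A F))"
    using F sub by (intro finite_surj[OF _ sub]) (simp add: asimplicial_iff total_cochains_carrier)
  moreover have "1 \<le> snd x" if "x \<in> support K C A (delta_S K C A F)" for x
    using F subsetD[OF sub that] by (auto simp: asimplicial_iff)
  ultimately show ?thesis
    by (simp add: asimplicial_iff total_cochains_carrier)
qed

end


section \<open>Trees and their free inputs\<close>

lemma exactly_one_exhaust:
  "exactly_one [a, b, c, d, e] \<Longrightarrow> a \<or> b \<or> c \<or> d \<or> e"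
  by (auto simp: exactly_one_def split: if_splits)

context
  fixes T :: "'a planar_tree"
  assumes T: "is_tree T"
begin

lemma tree_edge_verts: "(a, b) \<in> edges T \<Longrightarrow> a \<in> verts T \<and> b \<in> verts T"
  using T by (auto simp: is_tree_def)

lemma tree_edge_le: "(a, b) \<in> edges T \<Longrightarrow> tree_le T a b"
  using tree_edge_verts by (auto simp: tree_le_def)

lemma tree_edge_less: "(a, b) \<in> edges T \<Longrightarrow> tree_less T a b"
  using T tree_edge_le by (auto simp: tree_less_def is_tree_def)

lemma tree_le_refl: "a \<in> verts T \<Longrightarrow> tree_le T a a"
  by (simp add: tree_le_def)

lemma tree_le_trans: "tree_le T a b \<Longrightarrow> tree_le T b c \<Longrightarrow> tree_le T a c"
  by (auto simp: tree_le_def)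

lemma tree_le_antisym: "tree_le T a b \<Longrightarrow> tree_le T b a \<Longrightarrow> a = b"
  using T by (auto simp: is_tree_def partial_order_on_def antisym_def)

lemma tree_edge_covers: "(a, b) \<in> edges T \<Longrightarrow> tree_less T a t \<Longrightarrow> \<not> tree_less T t b"
  using T by (auto simp: is_tree_def)

lemma tree_cases:
  assumes "u \<in> verts T" "v \<in> verts T"
  obtains "u = v" | "tree_less T u v" | "tree_less T v u" | "left_of T u v" | "left_of T v u"
proof -
  have "exactly_one [u = v, tree_less T u v, tree_less T v u, left_of T u v, left_of T v u]"
    using T assms by (simp add: is_tree_def)
  then show thesis
    using that by (blast dest: exactly_one_exhaust)
qed

text \<open>The compatibility of the two orders would place \<open>t\<close> to the left of
  itself.\<close>

lemma left_of_no_common_upper_bound: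
  assumes "left_of T u v" "tree_le T u t" "tree_le T v t"
  shows False
proof -
  have "left_of T t t"
    using T assms unfolding is_tree_def by blast
  then show False
    by (simp add: left_of_def)
qed

text \<open>Of two comparable siblings one would lie strictly between the parent and the other,
  against the covering condition on edges.\<close>

lemma siblings_left_of:
  assumes e: "(a, b) \<in> edges T" "(a, c) \<in> edges T" and "b \<noteq> c"
  shows "left_of T b c \<or> left_of T c b"
  using tree_edge_verts[OF e(1)] tree_edge_verts[OF e(2)] tree_edge_covers[OF e(1), of c]
    tree_edge_covers[OF e(2), of b] tree_edge_less[OF e(1)] tree_edge_less[OF e(2)] \<open>b \<noteq> c\<close>
  by (auto elim: tree_cases[of b c])

lemma siblings_no_common_upper_bound:
  assumes "(a, b) \<in> edges T" "(a, c) \<in> edges T" "tree_le T b t" "tree_le T c t"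
  shows "b = c"
  using assms siblings_left_of left_of_no_common_upper_bound by blast

text \<open>Of two comparable parents the larger would lie strictly between the other and
  \<open>c\<close>; parents side by side cannot share the upper bound \<open>c\<close>.\<close>

lemma tree_parent_unique:
  assumes e: "(a, c) \<in> edges T" "(b, c) \<in> edges T"
  shows "a = b"
proof (rule tree_cases[of a b])
  show "a \<in> verts T" "b \<in> verts T"
    using assms tree_edge_verts by auto
qed (use e tree_edge_covers tree_edge_less tree_edge_le left_of_no_common_upper_bound in blast)+

text \<open>Antisymmetry of the generated order excludes cycles in the finite edge set. This permits
  induction from parents to children.\<close>

lemma wf_edges: "wf (edges T)"
proof (rule finite_acyclic_wf)
  have "finite (verts T \<times> verts T)" "edges T \<subseteq> verts T \<times> verts T"
    using T by (auto simp: is_tree_def)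
  then show "finite (edges T)"
    by (rule rev_finite_subset)
  show "acyclic (edges T)"
    unfolding acyclic_def
  proof (intro allI notI)
    fix b assume "(b, b) \<in> (edges T)\<^sup>+"
    then obtain c where c: "(b, c) \<in> edges T" "(c, b) \<in> (edges T)\<^sup>*"
      by (meson tranclD)
    then have "tree_le T c b"
      using tree_edge_verts by (auto simp: tree_le_def)
    with c tree_edge_le tree_edge_less tree_le_antisym show False
      by (metis tree_less_def)
  qed
qed

lemma finite_edges: "finite (edges T)"
  using T by (auto simp: is_tree_def intro: finite_subset[of _ "verts T \<times> verts T"])

section \<open>The root and the number of edges\<close>

lemma is_root_tree_root: "is_root T (tree_root T)"
proof -
  have "\<exists>!r. is_root T r"
    using T by (auto simp: is_tree_def)
  then show ?thesis
    unfolding tree_root_def by (rule theI')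
qed

lemma tree_root_verts: "tree_root T \<in> verts T"
  using is_root_tree_root by (simp add: is_root_def)

lemma is_root_unique: "is_root T r \<Longrightarrow> r = tree_root T"
  using T is_root_tree_root by (auto simp: is_tree_def)

lemma not_root_has_parent:
  assumes v: "v \<in> verts T" "v \<noteq> tree_root T"
  obtains w where "(w, v) \<in> edges T"
proof -
  obtain u where u: "tree_le T u v" "u \<noteq> v"
    using v is_root_unique[of v] by (auto simp: is_root_def)
  then have "(u, v) \<in> (edges T)\<^sup>+"
    by (auto simp: tree_le_def rtrancl_eq_or_trancl)
  then show thesis
    using that by (meson tranclD2)
qed

lemma tree_root_le: "v \<in> verts T \<Longrightarrow> tree_le T (tree_root T) v"
proof (induction v rule: wf_induct_rule[OF wf_edges])
  case (1 v)
  show ?case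
  proof (cases "v = tree_root T")
    case True
    then show ?thesis using 1(2) by (simp add: tree_le_refl)
  next
    case False
    then obtain w where "(w, v) \<in> edges T"
      using not_root_has_parent 1(2) by blast
    then show ?thesis
      using 1(1) tree_edge_verts tree_edge_le tree_le_trans by blast
  qed
qed

text \<open>Sending an edge to its upper end is a bijection onto the vertices other than the root,
  as each of these has exactly one parent.\<close>

lemma card_edges: "Suc (card (edges T)) = card (verts T)"
proof -
  have "bij_betw snd (edges T) (verts T - {tree_root T})"
    unfolding bij_betw_def
  proof
    show "inj_on snd (edges T)"
      using tree_parent_unique by (auto simp: inj_on_def)
    have "b \<noteq> tree_root T" if "(a, b) \<in> edges T" for a b
      using is_root_tree_root tree_edge_less[OF that] by (auto simp: is_root_def tree_less_def)
    moreover have "v \<in> snd ` edges T" if v: "v \<in> verts T" "v \<noteq> tree_root T" for v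
    proof -
      obtain w where "(w, v) \<in> edges T" by (rule not_root_has_parent[OF v])
      then show ?thesis by force
    qed
    ultimately show "snd ` edges T = verts T - {tree_root T}"
      using tree_edge_verts by auto
  qed
  then have "card (edges T) = card (verts T - {tree_root T})"
    by (rule bij_betw_same_card)
  moreover have "finite (verts T)"
    using T by (simp add: is_tree_def)
  ultimately show ?thesis
    using tree_root_verts by (metis card_Suc_Diff1)
qed

lemma tree_le_cases:
  assumes "tree_le T a c"
  obtains "c = a" | b where "(a, b) \<in> edges T" "tree_le T b c"
proof -
  have "(a, c) \<in> (edges T)\<^sup>*" and c: "c \<in> verts T"
    using assms by (auto simp: tree_le_def)
  from this(1) show thesis
  proof (cases rule: converse_rtranclE)
    case base
    then show ?thesis using that by simp
  next
    case (step b)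
    then show ?thesis
      using that(2)[of b] c tree_edge_verts by (auto simp: tree_le_def)
  qed
qed

end

section \<open>Tree colorings and the inputs they leave free\<close>

context
  fixes T :: "nat planar_tree" and q :: "nat \<Rightarrow> nat" and I :: "nat \<times> nat \<Rightarrow> nat"
  assumes T: "is_tree T" and I: "I \<in> tree_colorings T q"
begin

lemma coloring_le: "(a, b) \<in> edges T \<Longrightarrow> 1 \<le> I (a, b) \<and> I (a, b) \<le> q a"
  using I by (auto simp: tree_colorings_def)

text \<open>Distinct siblings are related by \<open>left_of\<close>, along which colors increase
  strictly.\<close>

lemma coloring_inj:
  assumes "(a, b) \<in> edges T" "(a, c) \<in> edges T" "I (a, b) = I (a, c)"
  shows "b = c"
proof (rule ccontr)
  assume "b \<noteq> c"
  then have "I (a, b) < I (a, c) \<or> I (a, c) < I (a, b)"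
    using siblings_left_of[OF T assms(1,2)] I assms(1,2) by (auto simp: tree_colorings_def)
  then show False
    using assms(3) by simp
qed

text \<open>\<open>child_at\<close> is defined with \<open>\<exists>!\<close>; injectivity of the
  coloring on siblings makes existence sufficient.\<close>

lemma child_at_eq_Some_iff: "child_at T I a i = Some b \<longleftrightarrow> (a, b) \<in> edges T \<and> I (a, b) = i"
proof
  assume *: "(a, b) \<in> edges T \<and> I (a, b) = i"
  then have "\<exists>!b. (a, b) \<in> edges T \<and> I (a, b) = i"
    using coloring_inj by blast
  with * show "child_at T I a i = Some b"
    by (auto simp: child_at_def intro!: the1_equality)
next
  assume c: "child_at T I a i = Some b"
  then have "\<exists>!b. (a, b) \<in> edges T \<and> I (a, b) = i"
    by (simp add: child_at_def split: if_splits)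
  from theI'[OF this] c show "(a, b) \<in> edges T \<and> I (a, b) = i"
    by (simp add: child_at_def split: if_splits)
qed

lemma child_at_eq_None_iff: "child_at T I a i = None \<longleftrightarrow> (\<forall>b. (a, b) \<in> edges T \<longrightarrow> I (a, b) \<noteq> i)"
  using child_at_eq_Some_iff[of a i] by (cases "child_at T I a i") auto

text \<open>Replaces the recursive list by an order-free description: a vertex above
  \<open>a\<close> is \<open>a\<close> itself or lies above a child of \<open>a\<close>, where the
  induction on the number of descendants applies.\<close>

lemma set_free_inputs:
  "a \<in> verts T \<Longrightarrow> set (free_inputs T q I a) =
     {(c, i). tree_le T a c \<and> 1 \<le> i \<and> i \<le> q c \<and> child_at T I c i = None}"
proof (induction a rule: measure_induct_rule[of "\<lambda>a. card (descendants T a)"])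
  case (less a)
  have IH: "set (free_inputs T q I b) =
      {(c, i). tree_le T b c \<and> 1 \<le> i \<and> i \<le> q c \<and> child_at T I c i = None}"
    if "(a, b) \<in> edges T" for b
    using that less.IH card_descendants_less[OF T that] tree_edge_verts[OF T that] by blast
  have "(c, i) \<in> set (free_inputs T q I a) \<longleftrightarrow>
      tree_le T a c \<and> 1 \<le> i \<and> i \<le> q c \<and> child_at T I c i = None" for c i
  proof
    assume "(c, i) \<in> set (free_inputs T q I a)"
    then obtain j where j: "1 \<le> j" "j \<le> q a" and "(c, i) \<in> set (case child_at T I a j of
        None \<Rightarrow> [(a, j)] | Some b \<Rightarrow> free_inputs T q I b)"
      using T by (subst (asm) free_inputs.simps) (auto simp del: upt_Suc)
    then show "tree_le T a c \<and> 1 \<le> i \<and> i \<le> q c \<and> child_at T I c i = None"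
      using less.prems
      by (auto split: option.splits simp: tree_le_refl[OF T] IH[OF child_at_edge]
          dest!: child_at_edge intro: tree_le_trans[OF T] tree_edge_le[OF T])
  next
    assume *: "tree_le T a c \<and> 1 \<le> i \<and> i \<le> q c \<and> child_at T I c i = None"
    then have "tree_le T a c" by simp
    then have "\<exists>j. 1 \<le> j \<and> j \<le> q a \<and> (c, i) \<in> set (case child_at T I a j of
        None \<Rightarrow> [(a, j)] | Some b \<Rightarrow> free_inputs T q I b)"
    \<comment> \<open>The witness is \<open>i\<close> itself if \<open>c = a\<close>, and otherwise
      the input taken by the edge to the child below \<open>c\<close>.\<close>
    proof (cases rule: tree_le_cases[OF T, consumes 1])
      case 1
      then show ?thesis
        using * by (intro exI[of _ i]) simp
    next
      case (2 b)
      then show ?thesis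
        using * coloring_le[OF 2(1)] child_at_eq_Some_iff[of a "I (a, b)" b]
        by (intro exI[of _ "I (a, b)"]) (simp add: IH)
    qed
    then show "(c, i) \<in> set (free_inputs T q I a)"
      using T by (subst free_inputs.simps) (auto simp del: upt_Suc)
  qed
  then show ?case
    by auto
qed

text \<open>Different inputs of \<open>a\<close> contribute disjoint lists: subtrees at different
  children share no vertex, and none of them contains \<open>a\<close>.\<close>

lemma distinct_free_inputs: "a \<in> verts T \<Longrightarrow> distinct (free_inputs T q I a)"
proof (induction a rule: measure_induct_rule[of "\<lambda>a. card (descendants T a)"])
  case (less a)
  let ?F = "\<lambda>i. case child_at T I a i of None \<Rightarrow> [(a, i)] | Some b \<Rightarrow> free_inputs T q I b"
  have disjoint: "set (?F i) \<inter> set (?F j) = {}" if "i \<noteq> j" for i j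
  proof (rule ccontr)
    assume "set (?F i) \<inter> set (?F j) \<noteq> {}"
    then obtain c k where c: "(c, k) \<in> set (?F i)" "(c, k) \<in> set (?F j)"
      by auto
    have *: "k = l \<and> c = a \<and> child_at T I a l = None \<or>
        (\<exists>b. (a, b) \<in> edges T \<and> I (a, b) = l \<and> tree_le T b c)"
      if "(c, k) \<in> set (?F l)" for l
      using that set_free_inputs tree_edge_verts[OF T]
      by (auto split: option.splits simp: child_at_eq_Some_iff)
    have "\<not> tree_le T b a" if "(a, b) \<in> edges T" for b
      using tree_edge_less[OF T that] tree_le_antisym[OF T] by (auto simp: tree_less_def)
    then show False
      using *[OF c(1)] *[OF c(2)] \<open>i \<noteq> j\<close> siblings_no_common_upper_bound[OF T] by metis
  qed
  \<comment> \<open>Generalized from the list of all inputs to any distinct list, so that list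
    induction applies.\<close>
  have "distinct (concat (map ?F xs))" if "distinct xs" for xs
    using that
  proof (induction xs)
    case (Cons i xs)
    have "distinct (?F i)"
      using less.IH card_descendants_less[OF T] tree_edge_verts[OF T]
      by (auto split: option.splits simp: child_at_eq_Some_iff)
    moreover have "set (?F i) \<inter> set (concat (map ?F xs)) = {}"
    proof -
      have "set (?F i) \<inter> set (?F j) = {}" if "j \<in> set xs" for j
        using that Cons.prems by (intro disjoint) auto
      then show ?thesis
        unfolding set_concat set_map by blast
    qed
    ultimately show ?case
      using Cons by simp
  qed simp
  then show ?case
    using T by (subst free_inputs.simps) (simp del: upt_Suc)
qed

text \<open>All inputs minus those taken by edges. Distinct edges take distinct inputs, and there is
  one edge fewer than vertices, which the \<open>1 +\<close> accounts for.\<close>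

lemma length_free_inputs:
  "length (free_inputs T q I (tree_root T)) = 1 + (\<Sum>a\<in>verts T. q a) - card (verts T)"
proof -
  let ?X = "SIGMA a:verts T. {1..q a}"
  let ?Y = "(\<lambda>(a, b). (a, I (a, b))) ` edges T"
  have fin: "finite (verts T)"
    using T by (simp add: is_tree_def)
  have sub: "?Y \<subseteq> ?X"
    using coloring_le tree_edge_verts[OF T] by auto
  have "set (free_inputs T q I (tree_root T)) = ?X - ?Y"
    using tree_root_le[OF T] by (auto simp: set_free_inputs tree_root_verts[OF T] child_at_eq_None_iff
        tree_le_def)
  then have "length (free_inputs T q I (tree_root T)) = card (?X - ?Y)"
    using distinct_card[OF distinct_free_inputs[OF tree_root_verts[OF T]]] by simp
  also have "\<dots> = card ?X - card ?Y"
    using finite_edges[OF T] sub by (intro card_Diff_subset) auto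
  also have "card ?X = (\<Sum>a\<in>verts T. q a)"
    using fin by simp
  also have "card ?Y = card (edges T)"
    using coloring_inj by (intro card_image) (auto simp: inj_on_def)
  finally show ?thesis
    using card_edges[OF T] by simp
qed

end


section \<open>Composites along trees\<close>

context
  fixes T :: "nat planar_tree" and q :: "nat \<Rightarrow> nat" and I :: "nat \<times> nat \<Rightarrow> nat"
    and K :: "('k, 'r) ring_scheme"
    and L :: "('k, 'v) module" and U V :: "nat \<Rightarrow> ('k, 'v) module"
    and node :: "nat \<Rightarrow> 'v list \<Rightarrow> 'v" and edge :: "nat \<Rightarrow> nat \<Rightarrow> 'v \<Rightarrow> 'v" and leaf :: "nat \<Rightarrow> 'v \<Rightarrow> 'v"
  assumes T: "is_tree T" and I: "I \<in> tree_colorings T q"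
    and node: "\<And>a. a \<in> verts T \<Longrightarrow> node a \<in> multilinear_maps K (U a) (q a) (V a)"
    and edge: "\<And>a b. (a, b) \<in> edges T \<Longrightarrow> edge a b \<in> linear_maps K (V b) (U a)"
    and leaf: "\<And>a. a \<in> verts T \<Longrightarrow> leaf a \<in> linear_maps K L (U a)"
begin

text \<open>The entry that \<open>tree_composite\<close> feeds into input \<open>i\<close> of
  \<open>a\<close>. It lies in \<open>U a\<close>; \<open>V b\<close> is the output space at
  \<open>b\<close>, and \<open>L\<close> contains the values at the free inputs.\<close>

definition composite_input :: "(nat \<times> nat \<Rightarrow> 'v) \<Rightarrow> nat \<Rightarrow> nat \<Rightarrow> 'v" where
  "composite_input u a i = (case child_at T I a i of
     None \<Rightarrow> leaf a (u (a, i))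
   | Some b \<Rightarrow> edge a b (tree_composite T q I node edge leaf u b))"

lemma tree_composite_eq:
  "tree_composite T q I node edge leaf u a = node a (map (composite_input u a) [1..<Suc (q a)])"
  using T by (subst tree_composite.simps) (simp add: composite_input_def[abs_def])

lemma free_inputs_child:
  assumes "(a, b) \<in> edges T"
  shows "set (free_inputs T q I b) \<subseteq> set (free_inputs T q I a)"
  using assms tree_edge_verts[OF T assms] tree_edge_le[OF T assms] tree_le_trans[OF T]
  by (auto simp: set_free_inputs[OF T I])

lemma free_inputs_self:
  assumes "a \<in> verts T" "1 \<le> i" "i \<le> q a" "child_at T I a i = None"
  shows "(a, i) \<in> set (free_inputs T q I a)"
  using assms tree_le_refl[OF T] by (simp add: set_free_inputs[OF T I])

text \<open>The induction passes to children because their free inputs are among those of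
  \<open>a\<close>. Later this discards changes at inputs outside a subtree.\<close>

lemma tree_composite_cong:
  "a \<in> verts T \<Longrightarrow> (\<And>x. x \<in> set (free_inputs T q I a) \<Longrightarrow> u x = w x) \<Longrightarrow>
    tree_composite T q I node edge leaf u a = tree_composite T q I node edge leaf w a"
proof (induction a rule: measure_induct_rule[of "\<lambda>a. card (descendants T a)"])
  case (less a)
  have "composite_input u a i = composite_input w a i" if i: "1 \<le> i" "i \<le> q a" for i
  proof (cases "child_at T I a i")
    case None
    then show ?thesis
      using less.prems(2)[OF free_inputs_self[OF less.prems(1) i None]]
      by (simp add: composite_input_def)
  next
    case (Some b)
    then have e: "(a, b) \<in> edges T" by (rule child_at_edge)
    have "tree_composite T q I node edge leaf u b = tree_composite T q I node edge leaf w b"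
      using tree_edge_verts[OF T e] free_inputs_child[OF e] less.prems(2)
      by (intro less.IH card_descendants_less[OF T e]) auto
    then show ?thesis
      by (simp add: composite_input_def Some)
  qed
  then have "map (composite_input u a) [1..<Suc (q a)] = map (composite_input w a) [1..<Suc (q a)]"
    by (intro map_cong refl) (auto simp del: upt_Suc)
  then show ?case
    by (simp only: tree_composite_eq)
qed

text \<open>The second conjunct supplies the tuple at which linearity of \<open>node a\<close> in a
  single entry is applied afterwards.\<close>

lemma tree_composite_closed:
  "a \<in> verts T \<Longrightarrow> u ` set (free_inputs T q I a) \<subseteq> carrier L \<Longrightarrow>
    tree_composite T q I node edge leaf u a \<in> carrier (V a) \<and>
    map (composite_input u a) [1..<Suc (q a)] \<in> tuples (U a) (q a)"
proof (induction a rule: measure_induct_rule[of "\<lambda>a. card (descendants T a)"])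
  case (less a)
  have "composite_input u a i \<in> carrier (U a)" if i: "1 \<le> i" "i \<le> q a" for i
  proof (cases "child_at T I a i")
    case None
    then show ?thesis
      using less.prems(2) free_inputs_self[OF less.prems(1) i None]
      by (auto simp: composite_input_def intro!: linear_maps_closed[OF leaf[OF less.prems(1)]])
  next
    case (Some b)
    then have e: "(a, b) \<in> edges T" by (rule child_at_edge)
    have "tree_composite T q I node edge leaf u b \<in> carrier (V b)"
      using less.IH[OF card_descendants_less[OF T e]] tree_edge_verts[OF T e] free_inputs_child[OF e]
        less.prems(2) by blast
    then show ?thesis
      by (simp add: composite_input_def Some linear_maps_closed[OF edge[OF e]])
  qed
  then have "map (composite_input u a) [1..<Suc (q a)] \<in> tuples (U a) (q a)"
    by (auto simp: tuples_def simp del: upt_Suc)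
  with multilinear_mapsD(1)[OF node[OF less.prems(1)] this] show ?case
    by (simp only: tree_composite_eq simp_thms)
qed

text \<open>Follow the path from \<open>a\<close> to the vertex carrying \<open>y\<close>: at each
  vertex on it one entry varies, linearly by induction, and \<open>node\<close> is linear in that
  entry.\<close>

lemma tree_composite_linear:
  "a \<in> verts T \<Longrightarrow> u ` set (free_inputs T q I a) \<subseteq> carrier L \<Longrightarrow> y \<in> set (free_inputs T q I a) \<Longrightarrow>
    (\<lambda>x. tree_composite T q I node edge leaf (u(y := x)) a) \<in> linear_maps K L (V a)"
proof (induction a rule: measure_induct_rule[of "\<lambda>a. card (descendants T a)"])
  case (less a)
  let ?X = "map (composite_input u a) [1..<Suc (q a)]"
  obtain c k where y: "y = (c, k)" by (cases y)
  have yc: "tree_le T a c" "1 \<le> k" "k \<le> q c" "child_at T I c k = None"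
    using less.prems by (auto simp: y set_free_inputs[OF T I])
  have no_loop: "\<not> tree_le T b a" if "(a, b) \<in> edges T" for b
    using tree_edge_less[OF T that] tree_le_antisym[OF T] by (auto simp: tree_less_def)
  text \<open>Only the input of \<open>a\<close> through which \<open>y\<close> is reached depends on the value at \<open>y\<close>.\<close>
  have "\<exists>i. 1 \<le> i \<and> i \<le> q a \<and> (\<lambda>x. composite_input (u(y := x)) a i) \<in> linear_maps K L (U a) \<and>
      (\<forall>j x. j \<noteq> i \<longrightarrow> composite_input (u(y := x)) a j = composite_input u a j)"
  proof (cases rule: tree_le_cases[OF T yc(1)])
    case 1
    have "composite_input (u(y := x)) a j = composite_input u a j" if "j \<noteq> k" for j x
    proof (cases "child_at T I a j")
      case None
      then show ?thesis using that 1 y by (simp add: composite_input_def)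
    next
      case (Some b)
      then have e: "(a, b) \<in> edges T" by (rule child_at_edge)
      \<comment> \<open>\<open>y\<close> is an input of \<open>a\<close>, and \<open>a\<close> lies
        in the subtree of none of its children.\<close>
      have "tree_composite T q I node edge leaf (u(y := x)) b = tree_composite T q I node edge leaf u b"
        using no_loop[OF e] tree_edge_verts[OF T e]
        by (intro tree_composite_cong) (auto simp: y 1 set_free_inputs[OF T I])
      then show ?thesis by (simp add: composite_input_def Some)
    qed
    moreover have "(\<lambda>x. composite_input (u(y := x)) a k) \<in> linear_maps K L (U a)"
      using leaf[OF less.prems(1)] yc(4) by (simp add: composite_input_def 1 y)
    ultimately show ?thesis
      using yc 1 by blast
  next
    case (2 b)
    note e = 2(1)
    have other: "composite_input (u(y := x)) a j = composite_input u a j" if "j \<noteq> I (a, b)" for j x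
    proof (cases "child_at T I a j")
      case None
      have "a \<noteq> c"
        using no_loop[OF e] 2(2) by auto
      then show ?thesis using None y by (simp add: composite_input_def)
    next
      case (Some b')
      then have e': "(a, b') \<in> edges T" "I (a, b') = j"
        by (simp_all add: child_at_eq_Some_iff[OF T I])
      \<comment> \<open>Subtrees at distinct siblings are disjoint.\<close>
      then have "\<not> tree_le T b' c"
        using siblings_no_common_upper_bound[OF T e e'(1) 2(2)] that by blast
      then have "tree_composite T q I node edge leaf (u(y := x)) b' = tree_composite T q I node edge leaf u b'"
        using tree_edge_verts[OF T e'(1)]
        by (intro tree_composite_cong) (auto simp: y set_free_inputs[OF T I])
      then show ?thesis by (simp add: composite_input_def Some)
    qed
    have "y \<in> set (free_inputs T q I b)"
      using yc 2 tree_edge_verts[OF T e] by (simp add: y set_free_inputs[OF T I])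
    moreover have "u ` set (free_inputs T q I b) \<subseteq> carrier L"
      using less.prems(2) free_inputs_child[OF e] by blast
    ultimately have "(\<lambda>x. tree_composite T q I node edge leaf (u(y := x)) b) \<in> linear_maps K L (V b)"
      using less.IH[OF card_descendants_less[OF T e]] tree_edge_verts[OF T e] by blast
    then have "(\<lambda>x. edge a b (tree_composite T q I node edge leaf (u(y := x)) b)) \<in> linear_maps K L (U a)"
      by (rule linear_maps_compose[OF _ edge[OF e]])
    moreover have "child_at T I a (I (a, b)) = Some b"
      using e by (simp add: child_at_eq_Some_iff[OF T I])
    ultimately have "(\<lambda>x. composite_input (u(y := x)) a (I (a, b))) \<in> linear_maps K L (U a)"
      by (simp add: composite_input_def)
    then show ?thesis
      using other coloring_le[OF T I e] by blast
  qed
  then obtain i where i: "1 \<le> i" "i \<le> q a"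
    and lin: "(\<lambda>x. composite_input (u(y := x)) a i) \<in> linear_maps K L (U a)"
    and other: "\<And>j x. j \<noteq> i \<Longrightarrow> composite_input (u(y := x)) a j = composite_input u a j"
    by blast
  \<comment> \<open>Inputs are numbered from 1 and list entries from 0, hence
    \<open>i - 1\<close>.\<close>
  have "map (composite_input (u(y := x)) a) [1..<Suc (q a)] =
      ?X[i - 1 := composite_input (u(y := x)) a i]" for x
    using i other by (intro nth_equalityI) (auto simp: nth_list_update simp del: upt_Suc)
  moreover have "(\<lambda>x. node a (?X[i - 1 := composite_input (u(y := x)) a i])) \<in> linear_maps K L (V a)"
  proof (rule linear_maps_compose[OF lin])
    show "(\<lambda>x. node a (?X[i - 1 := x])) \<in> linear_maps K (U a) (V a)"
      using i tree_composite_closed[OF less.prems(1,2)]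
      by (intro multilinear_mapsD(2)[OF node[OF less.prems(1)]]) auto
  qed
  ultimately show ?case
    by (simp only: tree_composite_eq)
qed

text \<open>The free inputs are distinct and as many as the entries of \<open>vs\<close>, so
  changing one entry changes the assignment at exactly one free input, where the composite is
  linear.\<close>

lemma tree_composite_multilinear:
  assumes L: "module K L" and h: "h \<in> linear_maps K (V (tree_root T)) W"
  shows "(\<lambda>vs\<in>tuples L (1 + (\<Sum>a\<in>verts T. q a) - card (verts T)).
      h (tree_composite T q I node edge leaf
        (\<lambda>x. the (map_of (zip (free_inputs T q I (tree_root T)) vs) x)) (tree_root T)))
    \<in> multilinear_maps K L (1 + (\<Sum>a\<in>verts T. q a) - card (verts T)) W"
proof (rule multilinear_mapsI[OF L])
  let ?r = "tree_root T" and ?m = "1 + (\<Sum>a\<in>verts T. q a) - card (verts T)"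
  let ?xs = "free_inputs T q I ?r"
  let ?u = "\<lambda>vs x. the (map_of (zip ?xs vs) x)"
  have r: "?r \<in> verts T" by (rule tree_root_verts[OF T])
  have len: "length ?xs = ?m" by (rule length_free_inputs[OF T I])
  have dist: "distinct ?xs" by (rule distinct_free_inputs[OF T I r])
  fix vs assume vs: "vs \<in> tuples L ?m"
  have u_nth: "?u ws (?xs ! j) = ws ! j" if "length ws = ?m" "j < ?m" for ws j
    using that len dist by (simp add: map_of_zip_nth)
  have u: "?u vs ` set ?xs \<subseteq> carrier L"
  proof (rule image_subsetI)
    fix y assume "y \<in> set ?xs"
    then obtain j where j: "j < ?m" "y = ?xs ! j"
      using len by (metis in_set_conv_nth)
    then have "?u vs y = vs ! j"
      using vs u_nth[of vs j] by (simp add: tuples_def)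
    also have "vs ! j \<in> carrier L"
      using vs j(1) nth_mem[of j vs] by (auto simp: tuples_def)
    finally show "?u vs y \<in> carrier L" .
  qed
  show "h (tree_composite T q I node edge leaf (?u vs) ?r) \<in> carrier W"
    using tree_composite_closed[OF r u] linear_maps_closed[OF h] by blast
  fix i assume i: "i < ?m"
  \<comment> \<open>Agreement is claimed on the free inputs only, where \<open>map_of\<close> has a
    value; the composite depends on nothing else.\<close>
  have "?u (vs[i := x]) y = ((?u vs)(?xs ! i := x)) y" if y: "y \<in> set ?xs" for x y
  proof -
    obtain j where j: "j < ?m" "y = ?xs ! j"
      using y len by (metis in_set_conv_nth)
    moreover have "?xs ! i = ?xs ! j \<longleftrightarrow> i = j"
      using i j len dist by (simp add: nth_eq_iff_index_eq)
    ultimately show ?thesis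
      using vs i u_nth[of vs] u_nth[of "vs[i := x]"] by (auto simp: tuples_def)
  qed
  then have "tree_composite T q I node edge leaf (?u (vs[i := x])) ?r =
      tree_composite T q I node edge leaf ((?u vs)(?xs ! i := x)) ?r" for x
    by (intro tree_composite_cong r)
  moreover have "(\<lambda>x. h (tree_composite T q I node edge leaf ((?u vs)(?xs ! i := x)) ?r))
      \<in> linear_maps K L W"
    using i len by (intro linear_maps_compose[OF _ h] tree_composite_linear r u) simp
  ultimately show "(\<lambda>x. h (tree_composite T q I node edge leaf (?u (vs[i := x])) ?r)) \<in> linear_maps K L W"
    by simp
qed

end


section \<open>Colorings of quilts\<close>

text \<open>Consecutive blocks share an end point, and \<open>Min \<le> Max\<close> in each block
  between links the chain.\<close>

lemma is_projection_blocks_le: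
  assumes \<pi>: "is_projection n W p \<zeta> \<pi>" and W: "set W \<subseteq> {1..n}"
    and "i < j" "j < length W"
  shows "Max (block p \<zeta> \<pi> (W ! i) i) \<le> Min (block p \<zeta> \<pi> (W ! j) j)"
  using assms(3,4)
proof (induction j rule: less_Suc_induct)
  case (1 i)
  then show ?case
    using \<pi> by (simp add: is_projection_def)
next
  case (2 i j k)
  have "W ! j \<in> {1..n}"
    using W 2 nth_mem[of j W] by (meson dual_order.strict_trans subsetD)
  \<comment> \<open>Every occurrence is hit by the projection, so the block is nonempty and its
    \<open>Min\<close> and \<open>Max\<close> are meaningful.\<close>
  then have "j \<in> \<pi> (W ! j) ` {0..p (W ! j)}"
    using \<pi> 2 by (auto simp: is_projection_def)
  then have "block p \<zeta> \<pi> (W ! j) j \<noteq> {}" "finite (block p \<zeta> \<pi> (W ! j) j)"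
    by (auto simp: block_def)
  then have "Min (block p \<zeta> \<pi> (W ! j) j) \<le> Max (block p \<zeta> \<pi> (W ! j) j)"
    by simp
  then show ?case
    using 2 by linarith
qed

text \<open>Supplies the arrow needed along an edge. By the first quilt condition no occurrence of
  \<open>b\<close> precedes one of \<open>a\<close>, and blocks are ordered as their positions
  are.\<close>

lemma word_coloring_edge_le:
  assumes Q: "(W, T) \<in> Quilt n" and \<zeta>: "\<zeta> \<in> word_colorings n W p" and e: "(a, b) \<in> edges T"
  shows "\<zeta> a (p a) \<le> \<zeta> b 0"
proof -
  obtain \<pi> where \<pi>: "is_projection n W p \<zeta> \<pi>"
    using \<zeta> by (auto simp: word_colorings_def)
  have W: "set W = {1..n}" and T: "is_tree T" and V: "verts T = {1..n}"
    and order: "\<And>i j. i < j \<Longrightarrow> j < length W \<Longrightarrow> \<not> tree_less T (W ! j) (W ! i)"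
    using Q by (auto simp: Quilt_def F2S_def Tree_def)
  have ab: "a \<in> {1..n}" "b \<in> {1..n}"
    using tree_edge_verts[OF T e] V by auto
  \<comment> \<open>The occurrences that receive the last value of \<open>\<zeta> a\<close> and the
    first value of \<open>\<zeta> b\<close>.\<close>
  let ?i = "\<pi> a (p a)" and ?j = "\<pi> b 0"
  have "?i \<in> \<pi> a ` {0..p a}" "?j \<in> \<pi> b ` {0..p b}"
    by auto
  moreover have "\<pi> c ` {0..p c} = {i. i < length W \<and> W ! i = c}" if "c \<in> {1..n}" for c
    using \<pi> that by (simp add: is_projection_def)
  ultimately have i: "?i < length W" "W ! ?i = a" and j: "?j < length W" "W ! ?j = b"
    using ab by blast+
  have less: "tree_less T a b"
    by (rule tree_edge_less[OF T e])
  \<comment> \<open>Equal positions would give \<open>a = b\<close>, and \<open>?j < ?i\<close>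
    would violate the quilt condition.\<close>
  then have "?i < ?j"
    using order[of ?j ?i] i j by (cases ?i ?j rule: linorder_cases) (auto simp: tree_less_def)
  have "\<zeta> a (p a) \<le> Max (block p \<zeta> \<pi> a ?i)" "Min (block p \<zeta> \<pi> b ?j) \<le> \<zeta> b 0"
    by (auto simp: block_def intro!: Max_ge Min_le)
  then show ?thesis
    using is_projection_blocks_le[OF \<pi> _ \<open>?i < ?j\<close> j(1)] W i j by simp
qed

text \<open>The sum of the \<open>q a\<close> is at least \<open>n\<close>, so the subtraction in
  \<open>out_q\<close> does not truncate and the 1 survives.\<close>

lemma out_q_positive:
  assumes "\<And>a. a \<in> {1..n} \<Longrightarrow> 1 \<le> q a"
  shows "1 \<le> out_q n q"
  using sum_mono[of "{1..n}" "\<lambda>_. 1" q] assms by (simp add: out_q_def)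


section \<open>Closure under quilts\<close>

context functor_to_vect
begin

text \<open>At each string this is an instance of the multilinearity of tree composites. Arrows of a
  string run from high to low positions, so every functor map needs an inequality between values of
  the coloring.\<close>

lemma coloring_action_in_cochains:
  assumes Q: "(W, T) \<in> Quilt n" and \<zeta>: "\<zeta> \<in> word_colorings n W p" and I: "I \<in> tree_colorings T q"
    and f: "\<And>a. a \<in> {1..n} \<Longrightarrow> f a \<in> carrier (cochains K C A (p a) (q a))"
  shows "coloring_action C A n W T p q \<zeta> I f \<in> carrier (cochains K C A (out_p n W p) (out_q n q))"
  unfolding cochains_carrier_iff coloring_action_def Let_def
proof (rule restrict_PiE_iff[THEN iffD2], rule ballI)
  fix \<phi> assume \<phi>: "\<phi> \<in> strings C (out_p n W p)"
  let ?p' = "out_p n W p" and ?r = "tree_root T"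
  have T: "is_tree T" and verts: "verts T = {1..n}"
    using Q by (auto simp: Quilt_def Tree_def)
  have \<zeta>_mono: "strict_mono_on {0..p a} (\<zeta> a)" and \<zeta>_le: "\<And>i. i \<le> p a \<Longrightarrow> \<zeta> a i \<le> ?p'"
    if "a \<in> {1..n}" for a
    using \<zeta> that by (auto simp: word_colorings_def PiE_iff)
  let ?\<psi> = "\<lambda>a. str_pull C (p a) (\<zeta> a) \<phi>"
  have \<psi>: "?\<psi> a \<in> strings C (p a)" if "a \<in> {1..n}" for a
    using \<zeta>_mono[OF that] \<zeta>_le[OF that]
    by (intro str_pull_in_strings[OF \<phi>] strict_mono_on_imp_mono_on) auto
  \<comment> \<open>All inputs of \<open>a\<close> live at the last value of
    \<open>\<zeta> a\<close>, its output at the first.\<close>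
  define U where "U a = FObj A (str_obj \<phi> (\<zeta> a (p a)))" for a
  define V where "V a = FObj A (str_obj \<phi> (\<zeta> a 0))" for a
  have r: "?r \<in> {1..n}"
    using tree_root_verts[OF T] verts by simp
  have out_q: "out_q n q = 1 + (\<Sum>a\<in>verts T. q a) - card (verts T)"
    by (simp add: out_q_def verts)
  show "(\<lambda>vs\<in>tuples (FObj A (str_obj \<phi> ?p')) (out_q n q).
        FArr A (str_arr C \<phi> 0 (\<zeta> ?r 0))
          (tree_composite T q I (\<lambda>a. f a (?\<psi> a))
            (\<lambda>a b. FArr A (str_arr C \<phi> (\<zeta> a (p a)) (\<zeta> b 0)))
            (\<lambda>a. FArr A (str_arr C \<phi> (\<zeta> a (p a)) ?p'))
            (\<lambda>x. the (map_of (zip (free_inputs T q I ?r) vs) x)) ?r))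
      \<in> multilinear_maps K (FObj A (str_obj \<phi> ?p')) (out_q n q) (FObj A (str_obj \<phi> 0))"
    unfolding out_q
  proof (rule tree_composite_multilinear[OF T I, where U = U and V = V])
    show "f a (?\<psi> a) \<in> multilinear_maps K (U a) (q a) (V a)" if "a \<in> verts T" for a
      using f[of a] \<psi>[of a] that
      by (auto simp: verts cochains_carrier_iff U_def V_def str_obj_str_pull dest!: PiE_mem)
    show "FArr A (str_arr C \<phi> (\<zeta> a (p a)) (\<zeta> b 0)) \<in> linear_maps K (V b) (U a)"
      if "(a, b) \<in> edges T" for a b
      unfolding U_def V_def using tree_edge_verts[OF T that] verts
      by (intro FArr_str_arr_linear[OF \<phi>] word_coloring_edge_le[OF Q \<zeta> that] \<zeta>_le) auto
    show "FArr A (str_arr C \<phi> (\<zeta> a (p a)) ?p') \<in> linear_maps K (FObj A (str_obj \<phi> ?p')) (U a)"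
      if "a \<in> verts T" for a
      unfolding U_def using that verts by (intro FArr_str_arr_linear[OF \<phi>] \<zeta>_le) auto
    show "module K (FObj A (str_obj \<phi> ?p'))"
      by (rule module_str_obj[OF \<phi>]) simp
    show "FArr A (str_arr C \<phi> 0 (\<zeta> ?r 0)) \<in> linear_maps K (V ?r) (FObj A (str_obj \<phi> 0))"
      unfolding V_def by (intro FArr_str_arr_linear[OF \<phi>] \<zeta>_le r) auto
  qed
qed

text \<open>A sign multiplies a cochain by an integer, which stays in the module whatever its
  value.\<close>

lemma quilt_op_bidegree_in_cochains:
  assumes "(W, T) \<in> Quilt n"
    and "\<And>a. a \<in> {1..n} \<Longrightarrow> f a \<in> carrier (cochains K C A (p a) (q a))"
  shows "quilt_op_bidegree K C A n (W, T) p q f \<in> carrier (cochains K C A (out_p n W p) (out_q n q))"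
proof -
  interpret M: module K "cochains K C A (out_p n W p) (out_q n q)" by (rule module_cochains)
  show ?thesis
    unfolding quilt_op_bidegree_def Let_def prod.case
    by (intro M.finsum_closed Pi_I M.add.int_pow_closed coloring_action_in_cochains assms)
qed

lemma quilt_op_in_asimplicial:
  assumes Q: "(W, T) \<in> Quilt n" and F: "\<And>a. a \<in> {1..n} \<Longrightarrow> F a \<in> asimplicial K C A"
  shows "quilt_op K C A n (W, T) F \<in> asimplicial K C A"
proof -
  interpret M: module K "total_cochains K C A" by (rule module_total_cochains)
  \<comment> \<open>\<open>d\<close> chooses a bidegree from the support of each argument, so every
    chosen \<open>q\<close> is at least 1 and the summand lies in the submodule.\<close>
  have "homogeneous K C A (out_p n W (\<lambda>a. fst (d a))) (out_q n (\<lambda>a. snd (d a)))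
      (quilt_op_bidegree K C A n (W, T) (\<lambda>a. fst (d a)) (\<lambda>a. snd (d a)) (\<lambda>a. F a (d a)))
    \<in> asimplicial K C A" if d: "d \<in> (\<Pi>\<^sub>E a\<in>{1..n}. support K C A (F a))" for d
  proof (intro homogeneous_in_asimplicial quilt_op_bidegree_in_cochains[OF Q] disjI1 out_q_positive)
    fix a assume a: "a \<in> {1..n}"
    show "F a (d a) \<in> carrier (cochains K C A (fst (d a)) (snd (d a)))"
      using F[OF a] total_cochains_carrier[of "F a"] by (cases "d a") (simp add: asimplicial_iff)
    show "1 \<le> snd (d a)"
      using F[OF a] PiE_mem[OF d a] by (simp add: asimplicial_iff)
  qed
  then show ?thesis
    unfolding quilt_op_def fst_conv
    by (intro M.submodule_finsum_closed[OF asimplicial_submodule] Pi_I)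
qed

end

theorem theorem4p28:
  fixes K :: "('k, 'r) ring_scheme"
    and C :: "('o, 'm) cat"
    and A :: "('o, 'm, 'k, 'v) vect_functor"
  assumes "field K"
    and "small_category C"
    and "functor_to_vect K C A"
  shows "quilt_subalgebra K C A (asimplicial K C A)"
proof -
  interpret functor_to_vect K C A by fact
  show ?thesis
    unfolding quilt_subalgebra_def subcomplex_def
    using asimplicial_submodule asimplicial_homogeneous_component delta_S_in_asimplicial
      quilt_op_in_asimplicial
    by auto
qed

end
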